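(* Let $m\ge4$. Every variety $\mathbf{V}$ of involution semigroups satisfying $\operatorname{var}\mathcal{K}_3^\rho\subseteq\mathbf{V}\subseteq\operatorname{var}\mathcal{W}_{m+1}^\rho$, or satisfying $\operatorname{var}\mathcal{K}_4^\rho\subseteq\mathbf{V}\subseteq\operatorname{var}\mathcal{W}_m^\rho$, is nonfinitely based.
   Context: For $n\ge2$, let $[n]=\{1,\dots,n\}$ and $[n]'=\{1',\dots,n'\}$. The wire monoid $\mathcal{W}_n$ has as elements all pairs $(\pi;d)$ where $\pi$ is a partition of $[n]\cup[n]'$ into 2-element blocks and $d\ge0$ is an integer. The product of $\xi=(\pi_1;d_1)$ and $\eta=(\pi_2;d_2)$ is defined as follows. Take a third disjoint copy $[n]''$ and form the multigraph $\Gamma$ on $[n]\cup[n]''\cup[n]'$ with edges: $\{\sigma(x),\sigma(y)\}$ for blocks $\{x,y\}$ of $\pi_1$, where $\sigma$ fixes $[n]$ and sends $k'\mapsto k''$; and $\{\tau(x),\tau(y)\}$ for blocks of $\pi_2$, where $\tau$ sends $k\mapsto k''$ and fixes $[n]'$. Then $\xi\eta=(\pi;d_1+d_2+m)$, where the blocks of $\pi$ are the endpoint pairs of the path components of $\Gamma$ and $m$ is the number of cycle components. The reflection is $(\pi;d)^*=(\pi^*;d)$, obtained by swapping $k\leftrightarrow k'$ in all blocks. The rotation is $\xi^\rho=\alpha\xi^*\alpha$, where $\alpha=(\{\{k,(n+1-k)'\}\mid k\in[n]\};0)$; it is an involution (involutory anti-automorphism). The hooks are $h_i=(\{\{i,i+1\},\{i',(i+1)'\}\}\cup\{\{j,j'\}\mid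 j\ne i,i+1\};0)$ and the circle is $c=(\{\{j,j'\}\mid j\in[n]\};1)$. The Kauffman monoid $\mathcal{K}_n$ is the submonoid of $\mathcal{W}_n$ generated by $c,h_1,\dots,h_{n-1}$; the rotation fixes $c$ and maps $h_i\mapsto h_{n-i}$. $\mathcal{W}_n^\rho$ and $\mathcal{K}_n^\rho$ denote $\mathcal{W}_n$ and $\mathcal{K}_n$ regarded as involution semigroups under the rotation. $\operatorname{var}$ denotes the generated variety of involution semigroups. A variety is nonfinitely based if it has no finite basis of identities. *)

theory Defs
  imports Main
begin

text \<open>Points of [n] \<union> [n]': Top k stands for k, Bot k stands for k'.\<close>
datatype pt = Top nat | Bot nat

definition pts :: "nat \<Rightarrow> pt set" where
  "pts n = Top ` {1..n} \<union> Bot ` {1..n}"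

definition is_pairing :: "nat \<Rightarrow> pt set set \<Rightarrow> bool" where
  "is_pairing n \<pi> \<longleftrightarrow> (\<forall>b\<in>\<pi>. b \<subseteq> pts n \<and> card b = 2) \<and> (\<forall>x\<in>pts n. \<exists>!b. b \<in> \<pi> \<and> x \<in> b)"

type_synonym wire = "pt set set \<times> nat"

definition W :: "nat \<Rightarrow> wire set" where
  "W n = {(\<pi>, d). is_pairing n \<pi>}"

text \<open>Vertices of the multigraph Gamma: GU k = k, GM k = k'', GL k = k'.\<close>
datatype gv = GU nat | GM nat | GL nat

fun sig :: "pt \<Rightarrow> gv" where
  "sig (Top k) = GU k" | "sig (Bot k) = GM k"

fun tau :: "pt \<Rightarrow> gv" where
  "tau (Top k) = GM k" | "tau (Bot k) = GL k"

fun outer :: "pt \<Rightarrow> gv" where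
  "outer (Top k) = GU k" | "outer (Bot k) = GL k"

definition gadj :: "pt set set \<Rightarrow> pt set set \<Rightarrow> gv \<Rightarrow> gv \<Rightarrow> bool" where
  "gadj \<pi>1 \<pi>2 x y \<longleftrightarrow> {x, y} \<in> (image sig) ` \<pi>1 \<or> {x, y} \<in> (image tau) ` \<pi>2"

definition gconn :: "pt set set \<Rightarrow> pt set set \<Rightarrow> gv \<Rightarrow> gv \<Rightarrow> bool" where
  "gconn \<pi>1 \<pi>2 = (gadj \<pi>1 \<pi>2)\<^sup>*\<^sup>*"

text \<open>Blocks of the product: endpoint pairs of the path components.\<close>
definition wprod_part :: "pt set set \<Rightarrow> pt set set \<Rightarrow> pt set set" where
  "wprod_part \<pi>1 \<pi>2 = {{a, b} | a b. a \<noteq> b \<and> gconn \<pi>1 \<pi>2 (outer a) (outer b)}"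

text \<open>Number of cycle components: components consisting of middle vertices only.\<close>
definition wcycles :: "nat \<Rightarrow> pt set set \<Rightarrow> pt set set \<Rightarrow> nat" where
  "wcycles n \<pi>1 \<pi>2 = card {C. \<exists>x \<in> GM ` {1..n}. C = {y. gconn \<pi>1 \<pi>2 x y} \<and> C \<subseteq> range GM}"

definition wmult :: "nat \<Rightarrow> wire \<Rightarrow> wire \<Rightarrow> wire" where
  "wmult n \<xi> \<eta> = (wprod_part (fst \<xi>) (fst \<eta>), snd \<xi> + snd \<eta> + wcycles n (fst \<xi>) (fst \<eta>))"

fun flip :: "pt \<Rightarrow> pt" where
  "flip (Top k) = Bot k" | "flip (Bot k) = Top k"

definition wstar :: "wire \<Rightarrow> wire" where
  "wstar \<xi> = ((image flip) ` fst \<xi>, snd \<xi>)"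

definition walpha :: "nat \<Rightarrow> wire" where
  "walpha n = ({{Top k, Bot (n + 1 - k)} | k. k \<in> {1..n}}, 0)"

definition rho :: "nat \<Rightarrow> wire \<Rightarrow> wire" where
  "rho n \<xi> = wmult n (wmult n (walpha n) (wstar \<xi>)) (walpha n)"

definition hook :: "nat \<Rightarrow> nat \<Rightarrow> wire" where
  "hook n i = ({{Top i, Top (i + 1)}, {Bot i, Bot (i + 1)}}
               \<union> {{Top j, Bot j} | j. j \<in> {1..n} \<and> j \<noteq> i \<and> j \<noteq> i + 1}, 0)"

definition circle :: "nat \<Rightarrow> wire" where
  "circle n = ({{Top j, Bot j} | j. j \<in> {1..n}}, 1)"

definition wone :: "nat \<Rightarrow> wire" where
  "wone n = ({{Top j, Bot j} | j. j \<in> {1..n}}, 0)"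

inductive_set K :: "nat \<Rightarrow> wire set" for n :: nat where
  K_one: "wone n \<in> K n"
| K_circle: "circle n \<in> K n"
| K_hook: "1 \<le> i \<Longrightarrow> i < n \<Longrightarrow> hook n i \<in> K n"
| K_mult: "x \<in> K n \<Longrightarrow> y \<in> K n \<Longrightarrow> wmult n x y \<in> K n"

datatype iterm = Var nat | Mul iterm iterm | Inv iterm

fun ieval :: "('a \<Rightarrow> 'a \<Rightarrow> 'a) \<Rightarrow> ('a \<Rightarrow> 'a) \<Rightarrow> (nat \<Rightarrow> 'a) \<Rightarrow> iterm \<Rightarrow> 'a" where
  "ieval mul iv f (Var x) = f x"
| "ieval mul iv f (Mul s t) = mul (ieval mul iv f s) (ieval mul iv f t)"
| "ieval mul iv f (Inv s) = iv (ieval mul iv f s)"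

definition Id_of :: "'a set \<Rightarrow> ('a \<Rightarrow> 'a \<Rightarrow> 'a) \<Rightarrow> ('a \<Rightarrow> 'a) \<Rightarrow> (iterm \<times> iterm) set" where
  "Id_of A mul iv = {(s, t). \<forall>f. (\<forall>x. f x \<in> A) \<longrightarrow> ieval mul iv f s = ieval mul iv f t}"

fun isubst :: "(nat \<Rightarrow> iterm) \<Rightarrow> iterm \<Rightarrow> iterm" where
  "isubst \<sigma> (Var x) = \<sigma> x"
| "isubst \<sigma> (Mul s t) = Mul (isubst \<sigma> s) (isubst \<sigma> t)"
| "isubst \<sigma> (Inv s) = Inv (isubst \<sigma> s)"

text \<open>Equational consequences of a set of identities in the variety of all involution
  semigroups (Birkhoff's complete equational logic, with the involution semigroup axioms).\<close>
inductive_set deriv :: "(iterm \<times> iterm) set \<Rightarrow> (iterm \<times> iterm) set" for \<Sigma> where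
  d_ax: "e \<in> \<Sigma> \<Longrightarrow> e \<in> deriv \<Sigma>"
| d_assoc: "(Mul (Mul x y) z, Mul x (Mul y z)) \<in> deriv \<Sigma>"
| d_antihom: "(Inv (Mul x y), Mul (Inv y) (Inv x)) \<in> deriv \<Sigma>"
| d_invol: "(Inv (Inv x), x) \<in> deriv \<Sigma>"
| d_refl: "(s, s) \<in> deriv \<Sigma>"
| d_sym: "(s, t) \<in> deriv \<Sigma> \<Longrightarrow> (t, s) \<in> deriv \<Sigma>"
| d_trans: "(s, t) \<in> deriv \<Sigma> \<Longrightarrow> (t, u) \<in> deriv \<Sigma> \<Longrightarrow> (s, u) \<in> deriv \<Sigma>"
| d_subst: "(s, t) \<in> deriv \<Sigma> \<Longrightarrow> (isubst \<sigma> s, isubst \<sigma> t) \<in> deriv \<Sigma>"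
| d_mul: "(s, t) \<in> deriv \<Sigma> \<Longrightarrow> (u, v) \<in> deriv \<Sigma> \<Longrightarrow> (Mul s u, Mul t v) \<in> deriv \<Sigma>"
| d_inv: "(s, t) \<in> deriv \<Sigma> \<Longrightarrow> (Inv s, Inv t) \<in> deriv \<Sigma>"

text \<open>A variety of involution semigroups is represented by its equational theory T
  (a set of identities closed under derivation); V = Mod T.\<close>
definition is_eq_theory :: "(iterm \<times> iterm) set \<Rightarrow> bool" where
  "is_eq_theory T \<longleftrightarrow> deriv T \<subseteq> T"

definition finitely_based :: "(iterm \<times> iterm) set \<Rightarrow> bool" where
  "finitely_based T \<longleftrightarrow> (\<exists>\<Sigma>. finite \<Sigma> \<and> deriv \<Sigma> = T)"

abbreviation IdW :: "nat \<Rightarrow> (iterm \<times> iterm) set" where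
  "IdW n \<equiv> Id_of (W n) (wmult n) (rho n)"

abbreviation IdK :: "nat \<Rightarrow> (iterm \<times> iterm) set" where
  "IdK n \<equiv> Id_of (K n) (wmult n) (rho n)"

end

theory Submission
  imports Defs "HOL-Library.Multiset" "HOL-Library.FuncSet" "HOL-Library.Nat_Bijection"
    "HOL-Library.Infinite_Set"
begin

text \<open>
  The Kauffman monoids \<open>K 3\<close> and \<open>K 4\<close> contain, next to the identity, a two-by-two Rees matrix
  semigroup over the powers of the circle, on which the rotation acts by \<open>(l, r) \<mapsto> (d r, d l)\<close>. The
  number of circles in a product counts the adjacent factors with matching indices. Hence an identity
  whose left-hand side uses every variable with one sign only preserves the multiset of letters and,
  after deletion of any letters, the first letter and the set of adjacent pairs.

  Such identities in fewer than about \<open>r\<close> variables cannot change a word of length \<open>r ^ m\<close> of a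
  suitable square-free fixed point of a uniform substitution. In a wire monoid, however, a product of
  generators is evaluated by a finite automaton with a counter, so that in a long enough word two
  adjacent factors can be exchanged; square-freeness makes the resulting identity nontrivial. No finite
  set of identities of the Kauffman monoid implies all of these.
\<close>


section \<open>Words with the same adjacencies\<close>

text \<open>Two finiteness requirements pull against each other. Rigidity under a finite set of
  identities needs an alphabet that grows with their length, whereas the exchange of two factors
  rests on a pigeonhole argument over a fixed finite alphabet and arbitrarily long prefixes. So
  \<open>r\<close> fixes the alphabet and only the exponent of the length stays free. Letters are
  pairs because images of variables need not respect the blocks of the substitution: two
  neighbouring letters must already reveal the parent letter, and they do if its two components
  alternate along the block. Images of length one reveal nothing; the bound on the number of
  variables yields a column that avoids them. Left-hand sides with both signs of a variable never
  match, because the word has only unstarred letters and images are nonempty.\<close>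

definition adjs :: "'a list \<Rightarrow> ('a \<times> 'a) set" where
  "adjs xs = set (zip xs (tl xs))"

lemma adjs_simps [simp]:
  "adjs [] = {}" "adjs [x] = {}" "adjs (x # y # zs) = insert (x, y) (adjs (y # zs))"
  by (auto simp: adjs_def)

lemma adjs_Cons: "adjs (x # xs) = (if xs = [] then {} else insert (x, hd xs) (adjs xs))"
  by (cases xs) auto

lemma adjs_append:
  "adjs (xs @ ys) = adjs xs \<union> adjs ys \<union> (if xs = [] \<or> ys = [] then {} else {(last xs, hd ys)})"
  by (induction xs) (auto simp: adjs_Cons)

lemma adjs_map: "adjs (map f xs) = map_prod f f ` adjs xs"
  by (induction xs) (auto simp: adjs_Cons hd_map)

lemma adjs_subset: "adjs xs \<subseteq> set xs \<times> set xs"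
  by (induction xs) (auto simp: adjs_Cons)

lemma adjs_upt: "adjs [a..<b] = {(p, Suc p) | p. a \<le> p \<and> Suc p < b}"
proof (induction b)
  case (Suc b)
  show ?case
  proof (cases "a < b")
    case True
    then have l: "last [a..<b] = b - 1" by simp
    show ?thesis using Suc True by (auto simp: adjs_append l)
  next
    case False then show ?thesis by (cases "a = b") auto
  qed
qed simp

lemma adjs_concat_map:
  assumes "\<forall>x\<in>set xs. g x \<noteq> []"
  shows "adjs (concat (map g xs)) =
    (\<Union>x\<in>set xs. adjs (g x)) \<union> (\<lambda>(x, y). (last (g x), hd (g y))) ` adjs xs"
  using assms
proof (induction xs)
  case (Cons x xs)
  show ?case
  proof (cases xs)
    case Nil then show ?thesis by simp
  next
    case (Cons y ys)
    then have "hd (concat (map g xs)) = hd (g y)" "concat (map g xs) \<noteq> []"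
      using Cons.prems by auto
    then show ?thesis using Cons.IH Cons.prems Cons by (auto simp: adjs_append)
  qed
qed simp

text \<open>The predicate \<open>Z\<close> tells which letters survive when the others are evaluated
  at the identity element. Deletion is part of the notion because images may become empty when only
  some columns of a word are kept.\<close>

definition same_adj :: "'a list \<Rightarrow> 'a list \<Rightarrow> bool" where
  "same_adj s t \<longleftrightarrow> mset s = mset t \<and>
     (\<forall>Z. filter Z s \<noteq> [] \<longrightarrow> hd (filter Z t) = hd (filter Z s)) \<and>
     (\<forall>Z. adjs (filter Z t) \<subseteq> adjs (filter Z s))"

lemma same_adj_set: "same_adj s t \<Longrightarrow> set t = set s"
  unfolding same_adj_def by (metis set_mset_mset)

lemma concat_map_filter_nonempty:
  "concat (map g s) = concat (map g (filter (\<lambda>x. g x \<noteq> []) s))"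
  by (induction s) auto

text \<open>Dropping the letters with empty image is a deletion, covered by \<open>Z\<close>. After
  that, an adjacent pair of the image lies inside one \<open>g x\<close> or at the seam of two
  consecutive images, so it depends only on the letters and their adjacencies.\<close>

lemma same_adj_concat:
  assumes "same_adj s t"
  shows "mset (concat (map g t)) = mset (concat (map g s))"
    and "concat (map g s) \<noteq> [] \<Longrightarrow> hd (concat (map g t)) = hd (concat (map g s))"
    and "adjs (concat (map g t)) \<subseteq> adjs (concat (map g s))"
proof -
  have m: "mset (concat (map g u)) = (\<Sum>x\<in>#mset u. mset (g x))" for u
    by (induction u) auto
  show "mset (concat (map g t)) = mset (concat (map g s))"
    using assms by (simp add: m same_adj_def)
  define Z where "Z = (\<lambda>x. g x \<noteq> [])"
  have c: "concat (map g u) = concat (map g (filter Z u))" for u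
    unfolding Z_def by (rule concat_map_filter_nonempty)
  have ne: "\<forall>x\<in>set (filter Z u). g x \<noteq> []" for u by (auto simp: Z_def)
  have st: "set (filter Z t) = set (filter Z s)" using same_adj_set[OF assms] by auto
  have a: "adjs (filter Z t) \<subseteq> adjs (filter Z s)" using assms by (auto simp: same_adj_def)
  have "adjs (concat (map g (filter Z t))) \<subseteq> adjs (concat (map g (filter Z s)))"
    unfolding adjs_concat_map[OF ne] st using a by blast
  then show "adjs (concat (map g t)) \<subseteq> adjs (concat (map g s))" by (simp flip: c)
  have h: "hd (concat (map g u)) = hd (g (hd u))" if "u \<noteq> []" "\<forall>x\<in>set u. g x \<noteq> []" for u
    using that by (cases u) auto
  assume "concat (map g s) \<noteq> []"
  then have fs: "filter Z s \<noteq> []" using c[of s] by auto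
  then have ft: "filter Z t \<noteq> []" using st by fastforce
  have "hd (filter Z t) = hd (filter Z s)" using assms fs by (auto simp: same_adj_def)
  then show "hd (concat (map g t)) = hd (concat (map g s))"
    using c[of s] c[of t] h[OF fs ne] h[OF ft ne] by simp
qed

text \<open>The common sequence of labels says which class supplies the next element, and each class
  is consumed in order.\<close>

lemma list_eq_if_filters_eq:
  assumes "map f xs = map f ys" and "\<And>c. filter (\<lambda>x. f x = c) xs = filter (\<lambda>x. f x = c) ys"
  shows "xs = ys"
proof -
  have "length xs = length ys" using assms(1) map_eq_imp_length_eq by blast
  then show ?thesis using assms
  proof (induction xs ys rule: list_induct2)
    case (Cons x xs y ys)
    have "x = y" using Cons.prems(1) Cons.prems(2)[of "f x"] by simp
    moreover have "filter (\<lambda>z. f z = c) xs = filter (\<lambda>z. f z = c) ys" for c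
      using Cons.prems(2)[of c] \<open>x = y\<close> by (auto split: if_splits)
    ultimately show ?case using Cons by simp
  qed simp
qed

lemma list_eq_if_map_snd_eq:
  assumes "map snd xs = map snd ys" "\<forall>x\<in>set xs. fst x = c" "\<forall>y\<in>set ys. fst y = c"
  shows "xs = ys"
proof -
  have "zs = map (Pair c) (map snd zs)" if "\<forall>z\<in>set zs. fst z = c" for zs :: "('b \<times> 'a) list"
    using that by (induction zs) auto
  then show ?thesis using assms by metis
qed

text \<open>Each \<open>lo\<close> entry is followed by its partner from the same block, so column
  \<open>lo\<close> alone determines the list. The condition \<open>fst a = lo\<close> excludes
  pairs that straddle two blocks.\<close>

lemma alternating_left:
  assumes "map fst A = concat (replicate n [lo, hi])" "lo \<noteq> hi"
    and "\<And>a b. (a, b) \<in> adjs A \<Longrightarrow> fst a = lo \<Longrightarrow> snd b = h (snd a)"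
  shows "A = concat (map (\<lambda>a. [a, (hi, h (snd a))]) (filter (\<lambda>a. fst a = lo) A))"
  using assms
proof (induction n arbitrary: A)
  case (Suc n)
  then obtain a b A' where A: "A = a # b # A'" "fst a = lo" "fst b = hi"
      "map fst A' = concat (replicate n [lo, hi])"
    by (auto simp: map_eq_Cons_conv)
  have sub: "adjs A' \<subseteq> adjs A" using A(1) by (auto simp: adjs_Cons)
  have "snd b = h (snd a)" using Suc.prems(3)[of a b] A by simp
  then have b: "b = (hi, h (snd a))" using A by (cases b) simp
  have "A' = concat (map (\<lambda>a. [a, (hi, h (snd a))]) (filter (\<lambda>a. fst a = lo) A'))"
    by (rule Suc.IH[OF A(4) Suc.prems(2)]) (use Suc.prems(3) sub in blast)+
  then show ?case using A b Suc.prems(2) by auto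
qed simp

lemma alternating_right:
  assumes "map fst A = concat (replicate n [lo, hi])" "lo \<noteq> hi"
    and "\<And>a b. (a, b) \<in> adjs A \<Longrightarrow> fst a = lo \<Longrightarrow> snd a = h (snd b)"
  shows "A = concat (map (\<lambda>b. [(lo, h (snd b)), b]) (filter (\<lambda>a. fst a = hi) A))"
  using assms
proof (induction n arbitrary: A)
  case (Suc n)
  then obtain a b A' where A: "A = a # b # A'" "fst a = lo" "fst b = hi"
      "map fst A' = concat (replicate n [lo, hi])"
    by (auto simp: map_eq_Cons_conv)
  have sub: "adjs A' \<subseteq> adjs A" using A(1) by (auto simp: adjs_Cons)
  have "snd a = h (snd b)" using Suc.prems(3)[of a b] A by simp
  then have b: "a = (lo, h (snd b))" using A by (cases a) simp
  have "A' = concat (map (\<lambda>b. [(lo, h (snd b)), b]) (filter (\<lambda>a. fst a = hi) A'))"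
    by (rule Suc.IH[OF A(4) Suc.prems(2)]) (use Suc.prems(3) sub in blast)+
  then show ?case using A b Suc.prems(2) by auto
qed simp

lemma filter_mod_upt:
  fixes r :: nat
  assumes "lo < hi" "hi < r"
  shows "filter (\<lambda>p. p mod r = lo \<or> p mod r = hi) [0..<n * r] =
    concat (map (\<lambda>q. [q * r + lo, q * r + hi]) [0..<n])"
proof (induction n)
  case (Suc n)
  have f0: "filter (\<lambda>p. p = lo \<or> p = hi) [0..<b] = (if b \<le> lo then [] else if b \<le> hi then [lo] else [lo, hi])" for b
    using assms by (induction b) auto
  have sh: "[n * r..<Suc n * r] = map (\<lambda>p. p + n * r) [0..<r]"
    by (simp add: map_add_upt add.commute)
  have "filter (\<lambda>p. p mod r = lo \<or> p mod r = hi) [n * r..<Suc n * r] =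
      map (\<lambda>p. p + n * r) (filter (\<lambda>p. p = lo \<or> p = hi) [0..<r])"
    unfolding sh filter_map by (rule arg_cong[where f = "map _"], rule filter_cong) auto
  also have "\<dots> = [n * r + lo, n * r + hi]" using assms by (simp add: f0)
  finally have e: "filter (\<lambda>p. p mod r = lo \<or> p mod r = hi) [n * r..<Suc n * r] = [n * r + lo, n * r + hi]" .
  have "[0..<Suc n * r] = [0..<n * r] @ [n * r..<Suc n * r]"
    using upt_add_eq_append[of 0 "n * r" r] by (simp add: add.commute)
  then show ?case using Suc e by simp
qed simp

lemma filter_mod_upt_single:
  fixes r :: nat
  assumes "j < r"
  shows "filter (\<lambda>p. p mod r = j) [0..<n * r] = map (\<lambda>q. q * r + j) [0..<n]"
proof (induction n)
  case (Suc n)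
  have f0: "filter (\<lambda>p. p = j) [0..<b] = (if b \<le> j then [] else [j])" for b
    by (induction b) auto
  have sh: "[n * r..<Suc n * r] = map (\<lambda>p. p + n * r) [0..<r]"
    by (simp add: map_add_upt add.commute)
  have "filter (\<lambda>p. p mod r = j) [n * r..<Suc n * r] =
      map (\<lambda>p. p + n * r) (filter (\<lambda>p. p = j) [0..<r])"
    unfolding sh filter_map by (rule arg_cong[where f = "map _"], rule filter_cong) auto
  then have e: "filter (\<lambda>p. p mod r = j) [n * r..<Suc n * r] = [n * r + j]"
    using assms by (simp add: f0)
  have "[0..<Suc n * r] = [0..<n * r] @ [n * r..<Suc n * r]"
    using upt_add_eq_append[of 0 "n * r" r] by (simp add: add.commute)
  then show ?case using Suc e by simp
qed simp

lemma map_mod_upt_eqI: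
  assumes "length ys = n" and "ys \<noteq> [] \<Longrightarrow> hd ys = 0"
    and "\<And>a b. (a, b) \<in> adjs ys \<Longrightarrow> b = Suc a mod r"
  shows "ys = map (\<lambda>p. p mod r) [0..<n]"
  using assms
proof (induction n arbitrary: ys)
  case (Suc n)
  then obtain zs z where z: "ys = zs @ [z]" "length zs = n" by (metis length_Suc_conv_rev)
  have IH: "zs = map (\<lambda>p. p mod r) [0..<n]"
    by (rule Suc.IH) (use z Suc.prems in \<open>auto simp: adjs_append\<close>)
  have "z = n mod r"
  proof (cases "zs = []")
    case True then show ?thesis using z Suc.prems by auto
  next
    case False
    then have "(last zs, z) \<in> adjs ys" using z by (simp add: adjs_append)
    then have "z = Suc (last zs) mod r" using Suc.prems by blast
    moreover have "last zs = (n - 1) mod r" using False IH z(2)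
      by (cases n) (auto simp: last_map)
    ultimately show ?thesis using False z(2) by (cases n) (auto simp: mod_Suc_eq)
  qed
  then show ?case using z IH by simp
qed simp


text \<open>Here \<open>G\<close> recodes the positions of the word \<open>F\<close>. A variable may
  occur at several places; as the recoding agrees on all occurrences of its image, the recoded image
  can be read off at any one of them.\<close>

lemma factorization_transfer:
  assumes "concat (map \<phi> s) = map F [0..<n]"
    and "\<And>x k p q. x \<in> set s \<Longrightarrow> \<phi> x = map F [p..<p + length (\<phi> x)] \<Longrightarrow>
      \<phi> x = map F [q..<q + length (\<phi> x)] \<Longrightarrow> k < length (\<phi> x) \<Longrightarrow> G (p + k) = G (q + k)"
  obtains \<psi> where "concat (map \<psi> s) = map G [0..<n]"
    and "\<And>x. x \<in> set s \<Longrightarrow>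
      \<exists>p. \<phi> x = map F [p..<p + length (\<phi> x)] \<and> \<psi> x = map G [p..<p + length (\<phi> x)]"
proof -
  define P where "P x = (SOME p. \<phi> x = map F [p..<p + length (\<phi> x)])" for x
  define \<psi> where "\<psi> x = map G [P x..<P x + length (\<phi> x)]" for x
  have P: "\<phi> x = map F [P x..<P x + length (\<phi> x)]" if "\<phi> x = map F [p..<p + length (\<phi> x)]" for x p
    unfolding P_def by (rule someI) (rule that)
  have "concat (map \<psi> u) = map G [a..<b] \<and>
      (\<forall>x\<in>set u. \<phi> x = map F [P x..<P x + length (\<phi> x)])"
    if "concat (map \<phi> u) = map F [a..<b]" "set u \<subseteq> set s" "a \<le> b" for u a b
    using that
  proof (induction u arbitrary: a)
    case (Cons x u)
    let ?l = "length (\<phi> x)"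
    have len: "a + ?l \<le> b" using arg_cong[OF Cons.prems(1), of length] Cons.prems(3) by simp
    have sp: "[a..<b] = [a..<a + ?l] @ [a + ?l..<b]"
      using len by (metis le_add1 le_add_diff_inverse upt_add_eq_append)
    have x: "\<phi> x = map F [a..<a + ?l]" and u: "concat (map \<phi> u) = map F [a + ?l..<b]"
      using Cons.prems(1) unfolding sp by (auto simp: append_eq_append_conv)
    note Px = P[OF x]
    have "map G [P x..<P x + ?l] = map G [a..<a + ?l]"
      by (rule nth_equalityI) (use assms(2)[OF _ Px x] Cons.prems(2) in auto)
    then show ?case using Cons.IH[OF u] Cons.prems(2) len sp Px by (simp add: \<psi>_def)
  qed simp
  from this[OF assms(1)] have 1: "concat (map \<psi> s) = map G [0..<n]"
    and 2: "\<forall>x\<in>set s. \<phi> x = map F [P x..<P x + length (\<phi> x)]" by auto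
  show thesis by (rule that[OF 1]) (use 2 \<psi>_def in auto)
qed

section \<open>A square-free word on a two-parameter alphabet\<close>

text \<open>The infinite word fixed by the substitution
  \<open>(a, b) \<mapsto> (0, a) (1, b) (2, a) (3, b) \<dots> (r - 1, _)\<close>: any two neighbouring letters of one block
  determine the letter from which the block arose.\<close>

function block_letter :: "nat \<Rightarrow> nat \<Rightarrow> nat \<times> nat" where
  "block_letter r p = (if p = 0 \<or> r < 2 then (0, 0) else
     (p mod r, if even (p mod r) then fst (block_letter r (p div r)) else snd (block_letter r (p div r))))"
  by auto
termination by (relation "measure snd") auto

declare block_letter.simps [simp del]

lemma block_letter_rec:
  assumes "r \<ge> 2"
  shows "block_letter r p = (p mod r, if even (p mod r) then fst (block_letter r (p div r)) else snd (block_letter r (p div r)))"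
  using assms by (cases "p = 0") (simp_all add: block_letter.simps[of r p] block_letter.simps[of r 0])

lemma fst_block_letter: "r \<ge> 2 \<Longrightarrow> fst (block_letter r p) = p mod r"
  by (subst block_letter_rec) auto

lemma snd_block_letter: "r \<ge> 2 \<Longrightarrow>
    snd (block_letter r p) = (if even (p mod r) then fst (block_letter r (p div r)) else snd (block_letter r (p div r)))"
  by (subst block_letter_rec) auto

text \<open>Neighbouring columns have opposite parity, so one letter shows the first component of
  the parent and the other the second. The bound on \<open>p mod r\<close> keeps both in one
  block.\<close>

lemma block_letter_block_eq:
  assumes r: "r \<ge> 2" and "block_letter r p = block_letter r q" "block_letter r (Suc p) = block_letter r (Suc q)" "p mod r < r - 1"
  shows "block_letter r (p div r) = block_letter r (q div r)"
proof -
  have m: "p mod r = q mod r" using assms fst_block_letter by metis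
  have s: "Suc p mod r = Suc (p mod r)" "Suc q mod r = Suc (q mod r)"
    "Suc p div r = p div r" "Suc q div r = q div r"
    using assms(4) m by (auto simp: mod_Suc div_Suc)
  have "snd (block_letter r p) = snd (block_letter r q)" "snd (block_letter r (Suc p)) = snd (block_letter r (Suc q))" using assms by auto
  then show ?thesis using m by (auto simp: snd_block_letter[OF r, of p] snd_block_letter[OF r, of q] snd_block_letter[OF r, of "Suc p"]
        snd_block_letter[OF r, of "Suc q"] s prod_eq_iff split: if_splits)
qed

text \<open>Descent by desubstitution. As there are more columns than variables, some inner column \<open>j\<close>
  has no letter that is itself the image of a variable. Every letter of column \<open>j\<close> then comes with a
  neighbour of its block, so it can be replaced by the letter from which the block arose; the induction
  hypothesis recovers column \<open>j\<close> of the image of \<open>t\<close>, and adjacency after deleting all but columns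
  \<open>i\<close> and \<open>j\<close> recovers column \<open>i\<close>.\<close>

lemma same_adj_block_letter:
  assumes st: "same_adj s t" and card: "card (set s) + 3 \<le> r"
  shows "concat (map \<phi> s) = map (block_letter r) [0..<r ^ m] \<Longrightarrow> concat (map \<phi> t) = map (block_letter r) [0..<r ^ m]"
proof (induction m arbitrary: \<phi>)
  case 0
  then have "mset (concat (map \<phi> t)) = {#block_letter r 0#}"
    using same_adj_concat(1)[OF st, of \<phi>] by simp
  then show ?case by simp
next
  case (Suc m)
  have r: "r \<ge> 2" using card by simp
  define n where "n = r ^ m"
  have eq: "concat (map \<phi> s) = map (block_letter r) [0..<n * r]"
    using Suc.prems by (simp add: n_def mult.commute)
  \<comment> \<open>There are \<open>r - 2\<close> inner columns and at most \<open>r - 3\<close>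
    letters. Looking at the first letter of each image suffices to avoid images of length one.
    Columns 0 and \<open>r - 1\<close> are excluded because the neighbour used below may lie on
    either side.\<close>
  have "\<not> {1..<r - 1} \<subseteq> (\<lambda>x. fst (hd (\<phi> x))) ` set s"
  proof
    assume "{1..<r - 1} \<subseteq> (\<lambda>x. fst (hd (\<phi> x))) ` set s"
    then have "card {1..<r - 1} \<le> card (set s)" by (meson List.finite_set surj_card_le)
    then show False using card by simp
  qed
  then obtain j where jr: "j \<in> {1..<r - 1}" and ji: "j \<notin> (\<lambda>x. fst (hd (\<phi> x))) ` set s"
    by blast
  have j: "0 < j" "j < r - 1" using jr by auto
  have jx: "\<phi> x \<noteq> [(j, v)]" if "x \<in> set s" for x v
  proof
    assume "\<phi> x = [(j, v)]"
    then have "fst (hd (\<phi> x)) = j" by simp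
    then show False using ji that by blast
  qed
  \<comment> \<open>Column \<open>j\<close> carries the whole parent letter and thus becomes a copy
    of the word of length \<open>r ^ m\<close>; the other columns keep their second component,
    padded with 0.\<close>
  define Tok where "Tok p = (p mod r, if p mod r = j then block_letter r (p div r) else (snd (block_letter r p), 0))" for p
  have fTok [simp]: "fst (Tok p) = p mod r" for p by (simp add: Tok_def)
  obtain \<psi> where \<psi>: "concat (map \<psi> s) = map Tok [0..<n * r]"
    "\<And>x. x \<in> set s \<Longrightarrow>
      \<exists>p. \<phi> x = map (block_letter r) [p..<p + length (\<phi> x)] \<and> \<psi> x = map Tok [p..<p + length (\<phi> x)]"
  proof (rule factorization_transfer[OF eq, of Tok])
    fix x k p q
    assume x: "x \<in> set s" and p: "\<phi> x = map (block_letter r) [p..<p + length (\<phi> x)]"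
      and q: "\<phi> x = map (block_letter r) [q..<q + length (\<phi> x)]" and k: "k < length (\<phi> x)"
    have W: "block_letter r (p + i) = block_letter r (q + i)" if "i < length (\<phi> x)" for i
      using arg_cong[OF p, of "\<lambda>l. l ! i"] arg_cong[OF q, of "\<lambda>l. l ! i"] that by simp
    have m: "(p + k) mod r = (q + k) mod r" using W[OF k] fst_block_letter[OF r] by metis
    show "Tok (p + k) = Tok (q + k)"
    proof (cases "(p + k) mod r = j")
      case True
      have "length (\<phi> x) \<noteq> 1"
      proof
        assume l: "length (\<phi> x) = 1"
        then have "\<phi> x = [block_letter r p]" using p by simp
        moreover have "fst (block_letter r p) = j" using True l k fst_block_letter[OF r] by simp
        ultimately show False using jx[OF x, of "snd (block_letter r p)"] by (metis prod.collapse)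
      qed
      \<comment> \<open>The image has another letter to the right or to the left of this one, and as
        \<open>j\<close> is an inner column, that letter lies in the same block.\<close>
      then consider "Suc k < length (\<phi> x)" | k' where "k = Suc k'" using k by (cases k) auto
      then have "block_letter r ((p + k) div r) = block_letter r ((q + k) div r)"
      proof cases
        case 1
        show ?thesis by (rule block_letter_block_eq[OF r]) (use W[OF k] W[OF 1] True j in auto)
      next
        case 2
        have sp: "Suc (p + k') mod r = j" "Suc (q + k') mod r = j" using True m 2 by auto
        have pm: "(p + k') mod r < r - 1" "Suc (p + k') div r = (p + k') div r"
          "Suc (q + k') div r = (q + k') div r"
          using sp j by (auto simp: mod_Suc div_Suc split: if_splits)
        have "block_letter r ((p + k') div r) = block_letter r ((q + k') div r)"
          by (rule block_letter_block_eq[OF r]) (use W[of k'] W[OF k] k pm 2 in auto)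
        then show ?thesis using 2 pm by simp
      qed
      then show ?thesis using m True by (simp add: Tok_def)
    next
      case False then show ?thesis using m W[OF k] by (simp add: Tok_def)
    qed
  qed (rule that)
  \<comment> \<open>Inverse of the recoding: a letter of column \<open>j\<close> is recomputed from
    its parent by the parity rule.\<close>
  define dec where "dec = (\<lambda>(c, w :: nat \<times> nat). (c :: nat, if c = j \<and> odd j then snd w else fst w))"
  have dTok: "dec (Tok p) = block_letter r p" for p
    by (auto simp: dec_def Tok_def prod_eq_iff fst_block_letter[OF r] snd_block_letter[OF r, of p])
  have dec: "map dec (concat (map \<psi> u)) = concat (map \<phi> u)" if "set u \<subseteq> set s" for u
    using that
  proof (induction u)
    case (Cons x u)
    then obtain p where p: "\<phi> x = map (block_letter r) [p..<p + length (\<phi> x)]"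
      "\<psi> x = map Tok [p..<p + length (\<phi> x)]" using \<psi>(2) by auto
    then have "map dec (\<psi> x) = \<phi> x" by (simp add: o_def dTok)
    then show ?case using Cons by simp
  qed simp
  define Y where "Y = concat (map \<psi> t)"
  define U where "U = map Tok [0..<n * r]"
  have same: "mset Y = mset U" "U \<noteq> [] \<Longrightarrow> hd Y = hd U" "adjs Y \<subseteq> adjs U"
    using same_adj_concat[OF st, of \<psi>] unfolding Y_def U_def \<psi>(1) by auto
  have lenY: "length Y = n * r" using same(1) by (metis U_def diff_zero length_map length_upt size_mset)
  have colsY: "map fst Y = map (\<lambda>p. p mod r) [0..<n * r]"
  proof (rule map_mod_upt_eqI)
    show "hd (map fst Y) = 0" if "map fst Y \<noteq> []"
    proof -
      have "length Y > 0" using that by simp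
      then have "n * r > 0" unfolding lenY .
      then show ?thesis using same(2) that by (auto simp: hd_map U_def upt_conv_Cons)
    qed
    show "b = Suc a mod r" if "(a, b) \<in> adjs (map fst Y)" for a b
    proof -
      obtain x y where "(x, y) \<in> adjs Y" "a = fst x" "b = fst y"
        using \<open>(a, b) \<in> adjs (map fst Y)\<close> by (auto simp: adjs_map)
      then show ?thesis using same(3) by (fastforce simp: U_def adjs_map adjs_upt mod_Suc_eq)
    qed
  qed (simp add: lenY)
  have colsU: "map fst U = map (\<lambda>p. p mod r) [0..<n * r]" by (simp add: U_def)
  have pj: "concat (map (\<lambda>x. map snd (filter (\<lambda>z. fst z = j) (\<psi> x))) u) =
      map snd (filter (\<lambda>z. fst z = j) (concat (map \<psi> u)))" for u
    by (induction u) auto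
  have Uj: "map snd (filter (\<lambda>z. fst z = j) U) = map (block_letter r) [0..<r ^ m]"
    using j by (simp add: U_def filter_map o_def filter_mod_upt_single Tok_def n_def)
  have "concat (map (\<lambda>x. map snd (filter (\<lambda>z. fst z = j) (\<psi> x))) s) = map (block_letter r) [0..<r ^ m]"
    unfolding pj \<psi>(1) using Uj unfolding U_def .
  from Suc.IH[OF this] have "map snd (filter (\<lambda>z. fst z = j) Y) = map (block_letter r) [0..<r ^ m]"
    unfolding pj Y_def .
  then have "map snd (filter (\<lambda>z. fst z = j) Y) = map snd (filter (\<lambda>z. fst z = j) U)" using Uj by simp
  then have fj: "filter (\<lambda>z. fst z = j) Y = filter (\<lambda>z. fst z = j) U"
    by (rule list_eq_if_map_snd_eq[of _ _ j]) auto
  have fi: "filter (\<lambda>z. fst z = i) Y = filter (\<lambda>z. fst z = i) U" for i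
  proof -
    consider "i = j" | "i \<ge> r" | "i < r" "i \<noteq> j" by linarith
    then show ?thesis
    proof cases
      case 1 then show ?thesis using fj by simp
    next
      case 2
      have "\<forall>z\<in>set Y. fst z < r" "\<forall>z\<in>set U. fst z < r"
        using arg_cong[OF colsY, of set] arg_cong[OF colsU, of set] r by force+
      then have "filter (\<lambda>z. fst z = i) Y = []" "filter (\<lambda>z. fst z = i) U = []"
        using 2 by (auto simp: filter_empty_conv)
      then show ?thesis by simp
    next
      case 3
      define lo hi where "lo = min i j" and "hi = max i j"
      have lh: "lo < hi" "hi < r" using 3 j by (auto simp: lo_def hi_def)
      define Z where "Z = (\<lambda>z :: nat \<times> nat \<times> nat. fst z = lo \<or> fst z = hi)"
      define A where "A = filter Z Y"
      define B where "B = filter Z U"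
      have B: "B = concat (map (\<lambda>q. [Tok (q * r + lo), Tok (q * r + hi)]) [0..<n])"
        unfolding B_def U_def Z_def filter_map o_def fTok filter_mod_upt[OF lh]
        by (simp add: map_concat o_def)
      have ft: "filter Z (concat (map \<psi> u)) = concat (map (\<lambda>x. filter Z (\<psi> x)) u)" for u
        by (induction u) auto
      have AB: "adjs A \<subseteq> adjs B"
        using same_adj_concat(3)[OF st, of "\<lambda>x. filter Z (\<psi> x)"]
        unfolding ft[symmetric] \<psi>(1) A_def B_def Y_def U_def .
      have fZ: "map fst (filter Z V) = filter (\<lambda>c. c = lo \<or> c = hi) (map fst V)" for V
        by (simp add: filter_map o_def Z_def)
      have cB: "map fst B = concat (replicate n [lo, hi])"
        unfolding B using lh by (induction n) (auto simp flip: replicate_append_same)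
      have cA: "map fst A = concat (replicate n [lo, hi])"
        using cB unfolding A_def B_def fZ colsY colsU .
      define h where "h w = (if even i then fst w else snd w, 0 :: nat)" for w :: "nat \<times> nat"
      have adjB: "\<exists>q. a = Tok (q * r + lo) \<and> b = Tok (q * r + hi)" if "(a, b) \<in> adjs B" "fst a = lo" for a b
      proof -
        have "adjs (concat (map (\<lambda>q. [Tok (q * r + lo), Tok (q * r + hi)]) [0..<n])) \<subseteq>
            {(a, b). fst a = lo \<longrightarrow> (\<exists>q. a = Tok (q * r + lo) \<and> b = Tok (q * r + hi))}"
          using lh by (subst adjs_concat_map) auto
        then show ?thesis using that B by blast
      qed
      have lohi: "lo = i \<and> hi = j \<or> lo = j \<and> hi = i" by (auto simp: lo_def hi_def)
      \<comment> \<open>The parity of \<open>i\<close> selects one component of the parent, and the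
        parent stands in column \<open>j\<close>.\<close>
      have Tij: "snd (Tok (q * r + i)) = h (snd (Tok (q * r + j)))" for q
        using 3 j by (simp add: Tok_def h_def snd_block_letter[OF r, of "q * r + i"])
      have fc: "filter (\<lambda>z. fst z = c) (filter Z V) = filter (\<lambda>z. fst z = c) V" if "c = i \<or> c = j" for c V
        unfolding filter_filter by (rule filter_cong) (use lohi that in \<open>auto simp: Z_def\<close>)
      have fA: "filter (\<lambda>a. fst a = j) A = filter (\<lambda>a. fst a = j) B"
        unfolding A_def B_def fc[OF disjI2[OF refl]] by (rule fj)
      have "A = B"
      proof (cases "lo = j")
        case True
        have c: "snd b = h (snd a)" if ab: "(a, b) \<in> adjs B" "fst a = lo" for a b
        proof -
          obtain q where "a = Tok (q * r + j)" "b = Tok (q * r + i)"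
            using adjB[OF ab] True lohi by auto
          then show ?thesis using Tij[of q] by simp
        qed
        have cA': "snd b = h (snd a)" if "(a, b) \<in> adjs A" "fst a = lo" for a b using AB c that by blast
        have "A = concat (map (\<lambda>a. [a, (hi, h (snd a))]) (filter (\<lambda>a. fst a = lo) A))"
          by (rule alternating_left[where h = h, OF cA _ cA']) (use lh in simp)
        also have "\<dots> = concat (map (\<lambda>a. [a, (hi, h (snd a))]) (filter (\<lambda>a. fst a = lo) B))"
          unfolding True fA ..
        also have "\<dots> = B"
          by (rule alternating_left[where h = h, OF cB _ c, symmetric]) (use lh in simp)
        finally show ?thesis .
      next
        case False
        then have hj: "hi = j" "lo = i" using lohi by auto
        have c: "snd a = h (snd b)" if ab: "(a, b) \<in> adjs B" "fst a = lo" for a b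
        proof -
          obtain q where "a = Tok (q * r + i)" "b = Tok (q * r + j)"
            using adjB[OF ab] hj by auto
          then show ?thesis using Tij[of q] by simp
        qed
        have cA': "snd a = h (snd b)" if "(a, b) \<in> adjs A" "fst a = lo" for a b using AB c that by blast
        have "A = concat (map (\<lambda>b. [(lo, h (snd b)), b]) (filter (\<lambda>a. fst a = hi) A))"
          by (rule alternating_right[where h = h, OF cA _ cA']) (use lh in simp)
        also have "\<dots> = concat (map (\<lambda>b. [(lo, h (snd b)), b]) (filter (\<lambda>a. fst a = hi) B))"
          unfolding hj fA ..
        also have "\<dots> = B"
          by (rule alternating_right[where h = h, OF cB _ c, symmetric]) (use lh in simp)
        finally show ?thesis .
      qed
      then have "filter Z Y = filter Z U" unfolding A_def B_def .
      then show ?thesis unfolding fc[OF disjI1[OF refl], of Y, symmetric] fc[OF disjI1[OF refl], of U, symmetric]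
        by (rule arg_cong)
    qed
  qed
  have "Y = U" by (rule list_eq_if_filters_eq[of fst, OF _ fi]) (simp only: colsY colsU)
  then have "map dec Y = map (block_letter r) [0..<n * r]" by (simp add: U_def dTok)
  then show ?case using dec[of t] same_adj_set[OF st] by (simp add: Y_def n_def mult.commute)
qed


text \<open>Descent on the period. Columns count modulo \<open>r\<close>, so the period is a
  multiple \<open>r * l\<close>, and the parents read off pairs of neighbours form a square of
  period \<open>l\<close>.\<close>

lemma block_letter_square_free:
  assumes r: "r \<ge> 4" and "L > 0"
  shows "\<not> (\<forall>i<L. block_letter r (p + i) = block_letter r (p + L + i))"
  using assms(2)
proof (induction L arbitrary: p rule: less_induct)
  case (less L)
  show ?case
  proof
    assume sq: "\<forall>i<L. block_letter r (p + i) = block_letter r (p + L + i)"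
    have r2: "r \<ge> 2" using r by simp
    have "p mod r = (p + L) mod r" using sq less.prems fst_block_letter[OF r2] by (metis add.right_neutral)
    then have "r dvd L" by (metis add_diff_cancel_left' le_add1 mod_eq_dvd_iff_nat)
    then obtain l where L: "L = r * l" by blast
    have l: "0 < l" "l < L" using L less.prems r by auto
    \<comment> \<open>A pair of neighbouring columns of one block within the first \<open>r\<close>
      positions of the square; its shifts by fewer than \<open>l\<close> blocks stay in the first
      half. If \<open>p\<close> lies in column 1, columns 2 and 3 serve, which exist as
      \<open>r\<close> is at least 4.\<close>
    obtain q j where j: "even j" "j + 1 < r" and lb: "p \<le> q * r + j" and ub: "q * r + j + 1 < p + r"
    proof -
      define k where "k = p div r"
      define e where "e = p mod r"
      have p: "p = k * r + e" "e < r" using r by (auto simp: k_def e_def)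
      consider "e = 0" | "e = 1" | "e \<ge> 2" by linarith
      then show ?thesis
      proof cases
        case 1 show ?thesis by (rule that[of 0 k]) (use 1 p r in auto)
      next
        case 2 show ?thesis by (rule that[of 2 k]) (use 2 p r in auto)
      next
        case 3 show ?thesis by (rule that[of 0 "Suc k"]) (use 3 p r in auto)
      qed
    qed
    have "block_letter r (q + i) = block_letter r (q + l + i)" if i: "i < l" for i
    proof -
      let ?a = "(q + i) * r + j"
      have "Suc i * r \<le> l * r" using i by (intro mult_le_mono1) simp
      then have ir: "i * r + r \<le> L" by (simp add: L mult.commute)
      have a: "p \<le> ?a" "?a + 1 < p + L" using lb ub ir by (auto simp: algebra_simps)
      have aL: "?a + L = (q + l + i) * r + j" by (simp add: L algebra_simps)
      have "block_letter r ?a = block_letter r (?a + L)"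
        using sq[rule_format, of "?a - p"] a by (simp add: algebra_simps)
      moreover have "block_letter r (Suc ?a) = block_letter r (Suc (?a + L))"
        using sq[rule_format, of "Suc ?a - p"] a by (simp add: algebra_simps)
      ultimately have "block_letter r (?a div r) = block_letter r ((?a + L) div r)"
        by (rule block_letter_block_eq[OF r2]) (use j in simp)
      then show ?thesis unfolding aL using j r by simp
    qed
    then show False using less.IH[OF l(2) l(1), of q] by blast
  qed
qed

text \<open>If adjacent factors \<open>a\<close>, \<open>b\<close> commute and \<open>a\<close> is
  not longer, then \<open>b\<close> begins with \<open>a\<close> and the word contains the square of
  \<open>a\<close>; otherwise \<open>a\<close> ends with \<open>b\<close> and the square of
  \<open>b\<close> lies around \<open>p1\<close>.\<close>

lemma block_letter_factors_not_commute:
  assumes r: "r \<ge> 4" and "p0 < p1" "p1 < p2"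
  shows "map (block_letter r) [p0..<p1] @ map (block_letter r) [p1..<p2] \<noteq> map (block_letter r) [p1..<p2] @ map (block_letter r) [p0..<p1]"
    (is "?a @ ?b \<noteq> ?b @ ?a")
proof
  assume eq: "?a @ ?b = ?b @ ?a"
  show False
  proof (cases "p1 - p0 \<le> p2 - p1")
    case True
    have "block_letter r (p0 + i) = block_letter r (p0 + (p1 - p0) + i)" if "i < p1 - p0" for i
      using arg_cong[OF eq, of "\<lambda>l. l ! i"] that True assms by (simp add: nth_append)
    then show False using block_letter_square_free[OF r, of "p1 - p0" p0] assms by auto
  next
    case False
    define L where "L = p2 - p1"
    obtain M where M: "p1 = p0 + M" using assms(2) less_imp_add_positive by blast
    have p2: "p2 = p1 + L" "L < M" using assms False M by (auto simp: L_def)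
    have "block_letter r (p1 - L + i) = block_letter r (p1 - L + L + i)" if "i < L" for i
    proof -
      have "(?a @ ?b) ! (M + i) = block_letter r (p1 + i)" using that M p2 by (simp add: nth_append)
      moreover have "(?b @ ?a) ! (M + i) = block_letter r (p1 - L + i)"
        using that M p2 by (simp add: nth_append ac_simps)
      ultimately show ?thesis using eq p2 M by simp
    qed
    then show False using block_letter_square_free[OF r, of L "p1 - L"] assms by (auto simp: L_def)
  qed
qed

section \<open>Words of terms and derivations\<close>

text \<open>A letter is a variable with a sign; \<open>True\<close> marks an unstarred occurrence.\<close>

definition winv :: "(nat \<times> bool) list \<Rightarrow> (nat \<times> bool) list" where
  "winv w = rev (map (\<lambda>(x, b). (x, \<not> b)) w)"

lemma winv_simps [simp]:
  "winv [] = []" "winv (u @ v) = winv v @ winv u" "winv (winv u) = u" "length (winv u) = length u"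
  "winv u = [] \<longleftrightarrow> u = []"
  by (auto simp: winv_def rev_map o_def case_prod_beta)

text \<open>The normal form of a term in the free involution semigroup.\<close>

fun word :: "iterm \<Rightarrow> (nat \<times> bool) list" where
  "word (Var x) = [(x, True)]"
| "word (Mul s t) = word s @ word t"
| "word (Inv s) = winv (word s)"

lemma word_nonempty [simp]: "word s \<noteq> []"
  by (induction s) auto

definition letter_subst :: "(nat \<Rightarrow> iterm) \<Rightarrow> nat \<times> bool \<Rightarrow> (nat \<times> bool) list" where
  "letter_subst \<sigma> z = (if snd z then word (\<sigma> (fst z)) else winv (word (\<sigma> (fst z))))"

lemma winv_concat_letter_subst:
  "winv (concat (map (letter_subst \<sigma>) l)) = concat (map (letter_subst \<sigma>) (winv l))"
  by (induction l) (auto simp: winv_def letter_subst_def rev_map o_def case_prod_beta)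

lemma word_isubst: "word (isubst \<sigma> s) = concat (map (letter_subst \<sigma>) (word s))"
  by (induction s) (auto simp: winv_concat_letter_subst, simp add: letter_subst_def)

lemma isubst_isubst: "isubst \<sigma> (isubst \<theta> s) = isubst (\<lambda>x. isubst \<sigma> (\<theta> x)) s"
  by (induction s) auto

lemma isubst_Var [simp]: "isubst Var s = s"
  by (induction s) auto

text \<open>Shaped to pass through every rule of the equational logic: \<open>\<sigma>\<close>
  absorbs instantiation, the contexts \<open>p\<close>, \<open>q\<close> multiplication, the
  reversed clause inversion, and the equivalence symmetry and transitivity.\<close>

definition word_invariant :: "(nat \<times> bool) list \<Rightarrow> iterm \<Rightarrow> iterm \<Rightarrow> bool" where
  "word_invariant U s t \<longleftrightarrow> (\<forall>\<sigma> p q.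
     (p @ word (isubst \<sigma> s) @ q = U \<longleftrightarrow> p @ word (isubst \<sigma> t) @ q = U) \<and>
     (p @ winv (word (isubst \<sigma> s)) @ q = U \<longleftrightarrow> p @ winv (word (isubst \<sigma> t)) @ q = U))"

lemma word_invariant_deriv:
  assumes "(s, t) \<in> deriv \<Sigma>" and "\<And>s t. (s, t) \<in> \<Sigma> \<Longrightarrow> word_invariant U s t"
  shows "word_invariant U s t"
proof -
  have "word_invariant U (fst e) (snd e)" if "e \<in> deriv \<Sigma>" for e
    using that
  proof (induction rule: deriv.induct)
    case (d_ax e) then show ?case using assms(2)[of "fst e" "snd e"] by simp
  next
    case (d_subst s t \<theta>) then show ?case by (simp add: word_invariant_def isubst_isubst)
  next
    case (d_mul s t u v)
    have "(p @ word (isubst \<sigma> s) @ word (isubst \<sigma> u) @ q = U) =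
        (p @ word (isubst \<sigma> t) @ word (isubst \<sigma> v) @ q = U)" for \<sigma> p q
    proof -
      have "(p @ word (isubst \<sigma> s) @ (word (isubst \<sigma> u) @ q) = U) =
          (p @ word (isubst \<sigma> t) @ (word (isubst \<sigma> u) @ q) = U)"
        using d_mul.IH(1) unfolding word_invariant_def fst_conv snd_conv by blast
      also have "\<dots> = ((p @ word (isubst \<sigma> t)) @ word (isubst \<sigma> u) @ q = U)" by simp
      also have "\<dots> = ((p @ word (isubst \<sigma> t)) @ word (isubst \<sigma> v) @ q = U)"
        using d_mul.IH(2) unfolding word_invariant_def fst_conv snd_conv by blast
      finally show ?thesis by simp
    qed
    moreover have "(p @ winv (word (isubst \<sigma> u)) @ winv (word (isubst \<sigma> s)) @ q = U) =
        (p @ winv (word (isubst \<sigma> v)) @ winv (word (isubst \<sigma> t)) @ q = U)" for \<sigma> p q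
    proof -
      have "(p @ winv (word (isubst \<sigma> u)) @ (winv (word (isubst \<sigma> s)) @ q) = U) =
          (p @ winv (word (isubst \<sigma> v)) @ (winv (word (isubst \<sigma> s)) @ q) = U)"
        using d_mul.IH(2) unfolding word_invariant_def fst_conv snd_conv by blast
      also have "\<dots> = ((p @ winv (word (isubst \<sigma> v))) @ winv (word (isubst \<sigma> s)) @ q = U)" by simp
      also have "\<dots> = ((p @ winv (word (isubst \<sigma> v))) @ winv (word (isubst \<sigma> t)) @ q = U)"
        using d_mul.IH(1) unfolding word_invariant_def fst_conv snd_conv by blast
      finally show ?thesis by simp
    qed
    ultimately show ?case by (simp add: word_invariant_def)
  qed (auto simp: word_invariant_def)
  from this[OF assms(1)] show ?thesis by simp
qed

definition one_signed :: "(nat \<times> bool) list \<Rightarrow> bool" where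
  "one_signed w \<longleftrightarrow> (\<forall>x. \<not> ((x, True) \<in> set w \<and> (x, False) \<in> set w))"

section \<open>Rigidity of the long word under short identities\<close>

definition block_word :: "nat \<Rightarrow> nat \<Rightarrow> (nat \<times> bool) list" where
  "block_word r m = map (\<lambda>p. (prod_encode (block_letter r p), True)) [0..<r ^ m]"

lemma Id_of_Mul: "(s, t) \<in> Id_of A mul iv \<Longrightarrow> (u, v) \<in> Id_of A mul iv \<Longrightarrow> (Mul s u, Mul t v) \<in> Id_of A mul iv"
  and Id_of_Inv: "(s, t) \<in> Id_of A mul iv \<Longrightarrow> (Inv s, Inv t) \<in> Id_of A mul iv"
  and Id_of_sym: "(s, t) \<in> Id_of A mul iv \<Longrightarrow> (t, s) \<in> Id_of A mul iv"
  and Id_of_refl: "(s, s) \<in> Id_of A mul iv"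
  by (auto simp: Id_of_def)

text \<open>Two fresh variables take \<open>p\<close> and \<open>q\<close> as images, so a match
  inside the word becomes a match of the whole word; as \<open>p\<close> and \<open>q\<close> may be
  empty, images are lists and not terms. A variable of \<open>s\<close> with both signs would put a
  letter and its star into the word. The 5 consists of the two fresh variables and the 3 in
  \<open>same_adj_block_letter\<close>.\<close>

lemma block_word_rewrite:
  assumes K: "\<And>s t. (s, t) \<in> Id_of A mul iv \<Longrightarrow> one_signed (word s) \<Longrightarrow> same_adj (word s) (word t)"
    and st: "(s, t) \<in> Id_of A mul iv" and len: "length (word s) + 5 \<le> r"
    and eq: "p @ word (isubst \<sigma> s) @ q = block_word r m"
  shows "p @ word (isubst \<sigma> t) @ q = block_word r m"
proof -
  let ?V = "fst ` (set (word s) \<union> set (word t))"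
  have fin: "finite ?V" by simp
  obtain n1 where n1: "n1 \<notin> ?V" using ex_new_if_finite[OF infinite_UNIV_nat fin] by blast
  obtain n2 where n2: "n2 \<notin> insert n1 ?V"
    using ex_new_if_finite[OF infinite_UNIV_nat finite.insertI[OF fin]] by blast
  define \<phi> where "\<phi> z = (if fst z = n1 then p else if fst z = n2 then q else letter_subst \<sigma> z)" for z
  define c where "c u = Mul (Mul (Var n1) u) (Var n2)" for u
  have wc: "word (c u) = (n1, True) # word u @ [(n2, True)]" for u by (simp add: c_def)
  have \<phi>c: "concat (map \<phi> (word (c u))) = p @ word (isubst \<sigma> u) @ q"
    if "fst ` set (word u) \<subseteq> ?V" for u
  proof -
    have "map \<phi> (word u) = map (letter_subst \<sigma>) (word u)"
      by (rule map_cong[OF refl]) (use that n1 n2 in \<open>auto simp: \<phi>_def\<close>)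
    moreover have "\<phi> (n1, True) = p" "\<phi> (n2, True) = q" using n2 by (auto simp: \<phi>_def)
    ultimately show ?thesis by (simp del: map_eq_conv add: wc word_isubst)
  qed
  have s: "concat (map \<phi> (word (c s))) = block_word r m" using eq \<phi>c[of s] by (simp add: image_Un)
  have sub: "set (\<phi> z) \<subseteq> set (block_word r m)" if "z \<in> set (word (c s))" for z
    using that by (auto simp flip: s)
  have os: "one_signed (word (c s))"
    unfolding one_signed_def
  proof (intro allI notI)
    fix x assume x: "(x, True) \<in> set (word (c s)) \<and> (x, False) \<in> set (word (c s))"
    then have "(x, False) \<in> set (word s)" by (auto simp: wc)
    then have "x \<in> ?V" by force
    then have ne: "x \<noteq> n1" "x \<noteq> n2" using n1 n2 by auto
    obtain y b w where y: "word (\<sigma> x) = (y, b) # w" by (metis word_nonempty list.exhaust prod.exhaust)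
    have "(y, b) \<in> set (block_word r m)" "(y, \<not> b) \<in> set (block_word r m)"
      using sub[of "(x, True)"] sub[of "(x, False)"] x ne y by (auto simp: \<phi>_def letter_subst_def winv_def)
    then show False by (auto simp: block_word_def)
  qed
  have "(c s, c t) \<in> Id_of A mul iv" unfolding c_def by (intro Id_of_Mul Id_of_refl st)
  then have sa: "same_adj (word (c s)) (word (c t))" using K os by blast
  define dec where "dec = (\<lambda>z :: nat \<times> bool. prod_decode (fst z))"
  define enc where "enc = (\<lambda>z :: nat \<times> nat. (prod_encode z, True))"
  have ed: "map enc (map dec (\<phi> z)) = \<phi> z" if "z \<in> set (word (c s))" for z
    unfolding map_map by (rule map_idI) (use sub[OF that] in \<open>auto simp: enc_def dec_def block_word_def\<close>)
  have mapc: "concat (map (\<lambda>z. map dec (\<phi> z)) l) = map dec (concat (map \<phi> l))" for l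
    by (induction l) auto
  have "concat (map (\<lambda>z. map dec (\<phi> z)) (word (c s))) = map (block_letter r) [0..<r ^ m]"
    unfolding mapc s by (simp add: block_word_def dec_def)
  moreover have "card (set (word (c s))) + 3 \<le> r"
    using card_length[of "word (c s)"] len by (simp add: wc)
  ultimately have "concat (map (\<lambda>z. map dec (\<phi> z)) (word (c t))) = map (block_letter r) [0..<r ^ m]"
    using same_adj_block_letter[OF sa] by blast
  then have "map enc (concat (map (\<lambda>z. map dec (\<phi> z)) (word (c t)))) = block_word r m"
    by (simp add: block_word_def enc_def)
  moreover have "map enc (concat (map (\<lambda>z. map dec (\<phi> z)) l)) = concat (map \<phi> l)"
    if "set l \<subseteq> set (word (c s))" for l
    using that
  proof (induction l)
    case (Cons z l) then show ?case using ed[of z] by simp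
  qed simp
  ultimately show ?thesis using \<phi>c[of t] same_adj_set[OF sa] by (simp add: image_Un)
qed

lemma block_word_word_invariant:
  assumes K: "\<And>s t. (s, t) \<in> Id_of A mul iv \<Longrightarrow> one_signed (word s) \<Longrightarrow> same_adj (word s) (word t)"
    and st: "(s, t) \<in> Id_of A mul iv" and len: "length (word s) + 5 \<le> r" "length (word t) + 5 \<le> r"
  shows "word_invariant (block_word r m) s t"
proof -
  have pres_dir: "p @ word (isubst \<sigma> s) @ q = block_word r m \<longleftrightarrow> p @ word (isubst \<sigma> t) @ q = block_word r m"
    if "(s, t) \<in> Id_of A mul iv" "length (word s) + 5 \<le> r" "length (word t) + 5 \<le> r" for s t \<sigma> p q
    using block_word_rewrite[OF K that(1,2)] block_word_rewrite[OF K Id_of_sym[OF that(1)] that(3)] by blast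
  show ?thesis
    unfolding word_invariant_def
    using pres_dir[OF st len] pres_dir[OF Id_of_Inv[OF st]] len by simp
qed


section \<open>Identities of wire monoids\<close>

text \<open>This makes \<open>Pow (Pow (pts n))\<close> a finite state set: a vertex outside the
  graph is connected only to itself, so no block leaves \<open>pts n\<close>.\<close>

lemma wprod_part_subset:
  assumes "\<pi>1 \<subseteq> Pow (pts n)" "\<pi>2 \<subseteq> Pow (pts n)"
  shows "wprod_part \<pi>1 \<pi>2 \<subseteq> Pow (pts n)"
proof -
  let ?V = "sig ` pts n \<union> tau ` pts n"
  have adj: "x \<in> ?V \<and> y \<in> ?V" if xy: "gadj \<pi>1 \<pi>2 x y" for x y
  proof -
    have "{x, y} \<subseteq> ?V" using xy assms unfolding gadj_def by blast
    then show ?thesis by simp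
  qed
  have conn: "x = y \<or> x \<in> ?V \<and> y \<in> ?V" if "gconn \<pi>1 \<pi>2 x y" for x y
    using that unfolding gconn_def by (induction rule: rtranclp_induct) (use adj in blast)+
  have out: "a \<in> pts n" if "outer a \<in> ?V" for a
  proof -
    have "a = b" if "outer a = sig b \<or> outer a = tau b" for b
      using that by (cases a; cases b) auto
    then show ?thesis using that by blast
  qed
  have "outer a = outer b \<longleftrightarrow> a = b" for a b by (cases a; cases b) auto
  then show ?thesis using conn out unfolding wprod_part_def by blast
qed

text \<open>The counter of the automaton: the circles gained by reading a list in state
  \<open>\<pi>\<close>. A prefix enters only through its pairing.\<close>

fun loops :: "nat \<Rightarrow> pt set set \<Rightarrow> wire list \<Rightarrow> nat" where
  "loops n \<pi> [] = 0"
| "loops n \<pi> (w # ws) = snd w + wcycles n \<pi> (fst w) + loops n (wprod_part \<pi> (fst w)) ws"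

lemma foldl_wmult:
  "foldl (wmult n) (\<pi>, d) ws = (foldl wprod_part \<pi> (map fst ws), d + loops n \<pi> ws)"
  by (induction ws arbitrary: \<pi> d) (auto simp: wmult_def)

fun lterm :: "nat list \<Rightarrow> iterm" where
  "lterm [] = Var 0"
| "lterm (x # xs) = foldl (\<lambda>t y. Mul t (Var y)) (Var x) xs"

lemma ieval_lterm: "ieval mul iv f (lterm (x # xs)) = foldl mul (f x) (map f xs)"
proof -
  have "ieval mul iv f (foldl (\<lambda>t y. Mul t (Var y)) t xs) = foldl mul (ieval mul iv f t) (map f xs)" for t
    by (induction xs arbitrary: t) auto
  then show ?thesis by simp
qed

lemma word_lterm: "xs \<noteq> [] \<Longrightarrow> word (lterm xs) = map (\<lambda>x. (x, True)) xs"
proof (cases xs)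
  case (Cons x ys)
  have "word (foldl (\<lambda>t y. Mul t (Var y)) t ys) = word t @ map (\<lambda>x. (x, True)) ys" for t
    by (induction ys arbitrary: t) auto
  then show ?thesis using Cons by simp
qed simp

lemma finite_pts: "finite (pts n)"
  by (simp add: pts_def)

text \<open>The pairing of a prefix ranges over a finite set, whatever the values of the variables. Between
  three prefixes with the same pairing function, the two intermediate segments act as loops of a finite
  automaton, and only the sum of the numbers of circles that they produce matters.\<close>

lemma IdW_swap:
  fixes w :: "nat \<Rightarrow> nat"
  assumes "finite (range w)"
  obtains p0 p1 p2 where "0 < p0" "p0 < p1" "p1 < p2"
    "\<And>v. (lterm (map w [0..<p0] @ map w [p0..<p1] @ map w [p1..<p2] @ v),
           lterm (map w [0..<p0] @ map w [p1..<p2] @ map w [p0..<p1] @ v)) \<in> IdW n"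
proof -
  let ?P = "Pow (Pow (pts n))"
  \<comment> \<open>\<open>S p\<close> records the state after the prefix of length \<open>p\<close>
    for all assignments to the finitely many letters at once, so the positions found by pigeonhole
    serve every assignment. Extensional function spaces keep the set of values finite.\<close>
  define S where "S p = (\<lambda>g\<in>range w \<rightarrow>\<^sub>E ?P. foldl wprod_part (g (w 0)) (map (\<lambda>i. g (w i)) [1..<p]))" for p
  have fl: "foldl wprod_part \<pi> l \<in> ?P" if "\<pi> \<in> ?P" "set l \<subseteq> ?P" for \<pi> l
    using that
  proof (induction l arbitrary: \<pi>)
    case (Cons x l)
    then show ?case using wprod_part_subset[of \<pi> n x] by auto
  qed simp
  have "S p \<in> (range w \<rightarrow>\<^sub>E ?P) \<rightarrow>\<^sub>E ?P" for p
    unfolding S_def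
  proof (intro restrict_PiE_iff[THEN iffD2] ballI)
    fix g assume "g \<in> range w \<rightarrow>\<^sub>E ?P"
    then have "g (w i) \<in> ?P" for i by (rule PiE_mem) simp
    then show "foldl wprod_part (g (w 0)) (map (\<lambda>i. g (w i)) [1..<p]) \<in> ?P"
      by (intro fl) (auto simp del: Pow_iff)
  qed
  moreover have "finite ((range w \<rightarrow>\<^sub>E ?P) \<rightarrow>\<^sub>E ?P)"
    using assms finite_pts by (intro finite_PiE) auto
  ultimately have fin: "finite (S ` {0<..})" by (meson finite_subset image_subsetI)
  obtain a where "infinite {p \<in> {0<..}. S p = S a}"
    using pigeonhole_infinite[OF infinite_Ioi fin] by blast
  then have inf: "\<exists>p>k. 0 < p \<and> S p = S a" for k by (auto simp: infinite_nat_iff_unbounded)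
  obtain p0 where p0: "0 < p0" "S p0 = S a" using inf by blast
  obtain p1 where p1: "p0 < p1" "S p1 = S a" using inf by blast
  obtain p2 where p2: "p1 < p2" "S p2 = S a" using inf by blast
  show thesis
  proof (rule that[OF p0(1) p1(1) p2(1)])
    fix v
    let ?b = "map w [p0..<p1]" and ?c = "map w [p1..<p2]"
    have w0: "map w [0..<p0] = w 0 # map w [1..<p0]" using p0 by (simp add: upt_conv_Cons)
    have "ieval (wmult n) (rho n) f (lterm (map w [0..<p0] @ ?b @ ?c @ v)) =
        ieval (wmult n) (rho n) f (lterm (map w [0..<p0] @ ?c @ ?b @ v))"
      if f: "\<forall>x. f x \<in> W n" for f
    proof -
      define \<pi> where "\<pi> = (\<lambda>p. foldl wprod_part (fst (f (w 0))) (map (\<lambda>i. fst (f (w i))) [1..<p]))"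
      have "fst (f x) \<in> ?P" for x
        using f[rule_format, of x] by (auto simp: W_def is_pairing_def)
      then have g: "restrict (fst \<circ> f) (range w) \<in> range w \<rightarrow>\<^sub>E ?P" by simp
      have "\<pi> p = S p (restrict (fst \<circ> f) (range w))" for p
        using g by (simp add: S_def \<pi>_def)
      then have eq: "\<pi> p1 = \<pi> p0" "\<pi> p2 = \<pi> p0" using p0 p1 p2 by auto
      have step: "foldl wprod_part (\<pi> p) (map fst (map f (map w [p..<q]))) = \<pi> q"
        if "0 < p" "p \<le> q" for p q
      proof -
        have "[1..<q] = [1..<p] @ [p..<q]" using that
          by (metis One_nat_def Suc_leI le_add_diff_inverse upt_add_eq_append)
        then show ?thesis by (simp add: \<pi>_def o_def)
      qed
      have sb: "foldl wprod_part (\<pi> p0) (map fst (map f ?b)) = \<pi> p0"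
        using step[of p0 p1] p0 p1 eq by simp
      have sc: "foldl wprod_part (\<pi> p0) (map fst (map f ?c)) = \<pi> p0"
        using step[of p1 p2] p0 p1 p2 eq by simp
      have pre: "foldl (wmult n) (f (w 0)) (map f (map w [1..<p0])) =
          (\<pi> p0, snd (f (w 0)) + loops n (fst (f (w 0))) (map f (map w [1..<p0])))"
        using foldl_wmult[of n "fst (f (w 0))" "snd (f (w 0))"] by (simp add: \<pi>_def o_def)
      show ?thesis
        unfolding w0 append_Cons ieval_lterm map_append foldl_append pre foldl_wmult sb sc
        by (simp add: add.commute add.left_commute)
    qed
    then show "(lterm (map w [0..<p0] @ ?b @ ?c @ v), lterm (map w [0..<p0] @ ?c @ ?b @ v)) \<in> IdW n"
      unfolding Id_of_def by blast
  qed
qed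

theorem not_finitely_based:
  fixes A :: "'a set"
  assumes T: "is_eq_theory T" "IdW n \<subseteq> T" "T \<subseteq> Id_of A mul iv"
    and K: "\<And>s t. (s, t) \<in> Id_of A mul iv \<Longrightarrow> one_signed (word s) \<Longrightarrow> same_adj (word s) (word t)"
  shows "\<not> finitely_based T"
proof
  assume "finitely_based T"
  then obtain \<Sigma> where \<Sigma>: "finite \<Sigma>" "deriv \<Sigma> = T" by (auto simp: finitely_based_def)
  define r where "r = (\<Sum>e\<in>\<Sigma>. length (word (fst e)) + length (word (snd e))) + 5"
  have len: "length (word s) + 5 \<le> r" "length (word t) + 5 \<le> r" if "(s, t) \<in> \<Sigma>" for s t
    using member_le_sum[OF that, of "\<lambda>e. length (word (fst e)) + length (word (snd e))"] \<Sigma>(1)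
    by (auto simp: r_def)
  have r: "r \<ge> 4" "r \<ge> 2" by (auto simp: r_def)
  have pr: "word_invariant (block_word r m) s t" if "(s, t) \<in> T" for s t m
  proof (rule word_invariant_deriv)
    show "(s, t) \<in> deriv \<Sigma>" using that \<Sigma> by simp
    show "word_invariant (block_word r m) s t" if "(s, t) \<in> \<Sigma>" for s t
      using block_word_word_invariant[OF K _ len[OF that]] deriv.d_ax[OF that] \<Sigma>(2) T(3) by blast
  qed
  define w where "w p = prod_encode (block_letter r p)" for p
  have bnd: "fst (block_letter r p) < r \<and> snd (block_letter r p) < r" for p
  proof (induction p rule: less_induct)
    case (less p)
    show ?case
    proof (cases "p = 0")
      case True then show ?thesis using r by (simp add: block_letter.simps)
    next
      case False
      then have "p div r < p" using r by simp
      then show ?thesis using less[of "p div r"] r by (subst (1 2) block_letter_rec) auto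
    qed
  qed
  have "range w \<subseteq> prod_encode ` ({..<r} \<times> {..<r})"
    using bnd by (force simp: w_def mem_Times_iff)
  then have "finite (range w)" by (rule finite_subset) simp
  then obtain p0 p1 p2 where p: "0 < p0" "p0 < p1" "p1 < p2"
    and id: "\<And>v. (lterm (map w [0..<p0] @ map w [p0..<p1] @ map w [p1..<p2] @ v),
           lterm (map w [0..<p0] @ map w [p1..<p2] @ map w [p0..<p1] @ v)) \<in> IdW n"
    using IdW_swap[of w n] by metis
  \<comment> \<open>Rigidity holds for every exponent, so the exponent only has to make the word
    contain both factors.\<close>
  have "p2 < r ^ p2" using r less_exp[of p2] power_mono[of 2 r p2] by (meson less_le_trans zero_le)
  then have sp: "[0..<r ^ p2] = [0..<p0] @ [p0..<p1] @ [p1..<p2] @ [p2..<r ^ p2]"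
  proof -
    have "[i..<j] @ [j..<k] = [i..<k]" if "i \<le> j" "j \<le> k" for i j k :: nat
      using that by (metis le_add_diff_inverse upt_add_eq_append)
    then show ?thesis using p \<open>p2 < r ^ p2\<close> by simp
  qed
  let ?u = "lterm (map w [0..<p0] @ map w [p0..<p1] @ map w [p1..<p2] @ map w [p2..<r ^ p2])"
  let ?v = "lterm (map w [0..<p0] @ map w [p1..<p2] @ map w [p0..<p1] @ map w [p2..<r ^ p2])"
  have block_word: "block_word r p2 = map (\<lambda>x. (x, True)) (map w [0..<r ^ p2])" by (simp add: block_word_def w_def)
  have "word ?u = block_word r p2" unfolding block_word sp using p by (subst word_lterm) auto
  moreover have "word_invariant (block_word r p2) ?u ?v" using id T(2) pr by blast
  ultimately have "word ?v = word ?u"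
    unfolding word_invariant_def by (metis append_Nil append_Nil2 isubst_Var)
  then have "map (\<lambda>x. (x, True)) (map w [p1..<p2] @ map w [p0..<p1]) =
      map (\<lambda>x. (x, True)) (map w [p0..<p1] @ map w [p1..<p2])"
    using p by (simp add: word_lterm)
  then have "map w [p1..<p2] @ map w [p0..<p1] = map w [p0..<p1] @ map w [p1..<p2]"
    by (rule map_injective) (simp add: inj_on_def)
  then have "map prod_encode (map (block_letter r) [p1..<p2] @ map (block_letter r) [p0..<p1]) =
      map prod_encode (map (block_letter r) [p0..<p1] @ map (block_letter r) [p1..<p2])"
    unfolding w_def[abs_def] by (simp add: o_def)
  then have "map (block_letter r) [p1..<p2] @ map (block_letter r) [p0..<p1] = map (block_letter r) [p0..<p1] @ map (block_letter r) [p1..<p2]"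
    by (rule map_injective) (rule inj_prod_encode)
  then show False using block_letter_factors_not_commute[OF r(1) p(2,3)] by simp
qed


section \<open>Rees matrix sections of Kauffman monoids\<close>

text \<open>The sum of the sandwich matrix entries met along a product in a Rees matrix semigroup,
  with entry 1 for equal indices and 0 otherwise.\<close>

definition matches :: "('a \<Rightarrow> bool) \<Rightarrow> ('a \<Rightarrow> bool) \<Rightarrow> 'a list \<Rightarrow> nat" where
  "matches l r xs = length (filter (\<lambda>(a, b). r a = l b) (zip xs (tl xs)))"

lemma matches_simps [simp]:
  "matches l r [] = 0" "matches l r [x] = 0"
  "matches l r (x # y # zs) = of_bool (r x = l y) + matches l r (y # zs)"
  by (auto simp: matches_def)

lemma matches_append:
  assumes "xs \<noteq> []" "ys \<noteq> []"
  shows "matches l r (xs @ ys) = matches l r xs + of_bool (r (last xs) = l (hd ys)) + matches l r ys"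
  using assms
proof (induction xs rule: list_nonempty_induct)
  case (single x) then show ?case by (cases ys) auto
next
  case (cons x xs) then show ?case by (cases xs) auto
qed

lemma matches_cong:
  assumes "\<And>x. x \<in> set xs \<Longrightarrow> l x = l' x" "\<And>x. x \<in> set xs \<Longrightarrow> r x = r' x"
  shows "matches l r xs = matches l' r' xs"
  using assms
proof (induction xs)
  case (Cons x xs) then show ?case by (cases xs) auto
qed simp

text \<open>With \<open>l = (\<lambda>y. y = b)\<close> and \<open>r = (\<lambda>x. x = a)\<close>, the number of matches is
  \<open>n - 1 - A - B + 2 k\<close>, where \<open>k\<close> counts the adjacent pairs \<open>(a, b)\<close> and \<open>A\<close>, \<open>B\<close> depend only on the
  multiset, the first and the last letter.\<close>

lemma adjs_eq_if_matches_eq: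
  assumes m: "mset u = mset v" and ne: "u \<noteq> []"
    and hd: "\<And>l :: 'a \<Rightarrow> bool. l (hd u) = l (hd v)" and last: "\<And>r :: 'a \<Rightarrow> bool. r (last u) = r (last v)"
    and mat: "\<And>l r. matches l r u = matches l r v"
  shows "adjs u = adjs v"
proof -
  have ne': "v \<noteq> []" using m ne by auto
  have hd': "hd u = hd v" using hd[of "\<lambda>x. x = hd v"] by simp
  have last': "last u = last v" using last[of "\<lambda>x. x = last v"] by simp
  have "mset u = add_mset (last u) (mset (butlast u))" "mset v = add_mset (last v) (mset (butlast v))"
    using ne ne' by (metis append_butlast_last_id mset.simps(2) mset_append add.commute mset_single_iff_right union_mset_add_mset_right add_0)+
  then have bl: "mset (butlast u) = mset (butlast v)" using m last' by simp
  have "mset u = add_mset (hd u) (mset (tl u))" "mset v = add_mset (hd v) (mset (tl v))"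
    using ne ne' by (metis list.collapse mset.simps(2))+
  then have tl: "mset (tl u) = mset (tl v)" using m hd' by simp
  have len: "length u = length v" using m by (metis size_mset)
  \<comment> \<open>For truth values as 0 and 1, \<open>[P = Q] + P + Q = 1 + 2 P Q\<close>; this is
    summed over all pairs.\<close>
  have pairs: "length (filter (\<lambda>(x, y). (x = a) = (y = b)) P) + length (filter (\<lambda>x. x = a) (map fst P))
      + length (filter (\<lambda>y. y = b) (map snd P)) = length P + 2 * length (filter (\<lambda>z. z = (a, b)) P)"
    for a b :: 'a and P
    by (induction P) auto
  have fz: "map fst (zip x (tl x)) = butlast x" "map snd (zip x (tl x)) = tl x" for x :: "'a list"
    by (simp_all add: map_fst_zip_take map_snd_zip_take butlast_conv_take)
  have filt: "length (filter p x) = length (filter p y)" if "mset x = mset y" for p and x y :: "'a list"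
    using that by (metis mset_filter size_mset)
  have "length (filter (\<lambda>z. z = (a, b)) (zip u (tl u))) = length (filter (\<lambda>z. z = (a, b)) (zip v (tl v)))" for a b
    using pairs[of a b "zip u (tl u)"] pairs[of a b "zip v (tl v)"] mat[of "\<lambda>y. y = b" "\<lambda>x. x = a"]
      filt[OF bl, of "\<lambda>x. x = a"] filt[OF tl, of "\<lambda>x. x = b"] len
    unfolding fz matches_def by simp
  then have "filter (\<lambda>z. z = (a, b)) (zip u (tl u)) = [] \<longleftrightarrow> filter (\<lambda>z. z = (a, b)) (zip v (tl v)) = []" for a b
    by (metis length_0_conv)
  then show ?thesis unfolding adjs_def by (auto simp: filter_empty_conv)
qed

text \<open>\<open>e0\<close> counts the circles that arise in every product of two elements
  \<open>E\<close>, and \<open>d\<close> is the action of the rotation on the indices: 0 and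
  negation for \<open>K 3\<close>, 1 and the identity map for \<open>K 4\<close>. The element
  \<open>one\<close> serves to delete variables.\<close>

locale rees_rotation =
  fixes A :: "'a set" and mul :: "'a \<Rightarrow> 'a \<Rightarrow> 'a" and iv :: "'a \<Rightarrow> 'a"
    and one :: 'a and E :: "bool \<Rightarrow> bool \<Rightarrow> nat \<Rightarrow> 'a" and e0 :: nat and d :: "bool \<Rightarrow> bool"
  assumes one_in: "one \<in> A" and E_in: "E l r k \<in> A"
    and mul_E: "mul (E l r k) (E l' r' k') = E l r' (k + k' + e0 + of_bool (r = l'))"
    and mul_one: "mul one one = one" "mul one (E l r k) = E l r k" "mul (E l r k) one = E l r k"
    and iv_E: "iv (E l r k) = E (d r) (d l) k" and iv_one: "iv one = one"
    and E_inj: "E l r k = E l' r' k' \<Longrightarrow> l = l' \<and> r = r' \<and> k = k'"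
    and E_one: "E l r k \<noteq> one"
    and d: "d = id \<or> d = Not"
begin

lemma d_involution [simp]: "d (d b) = b" "d a = d b \<longleftrightarrow> a = b"
  using d by auto

text \<open>The left index of a signed letter when \<open>x\<close> is evaluated at
  \<open>E (L x) (R x)\<close>; for a starred letter the rotation exchanges the indices and applies
  \<open>d\<close>.\<close>

definition lft :: "(nat \<Rightarrow> bool) \<Rightarrow> (nat \<Rightarrow> bool) \<Rightarrow> nat \<times> bool \<Rightarrow> bool" where
  "lft L R z = (if snd z then L (fst z) else d (R (fst z)))"

definition rgt :: "(nat \<Rightarrow> bool) \<Rightarrow> (nat \<Rightarrow> bool) \<Rightarrow> nat \<times> bool \<Rightarrow> bool" where
  "rgt L R z = (if snd z then R (fst z) else d (L (fst z)))"

definition cost :: "(nat \<Rightarrow> bool) \<Rightarrow> (nat \<Rightarrow> bool) \<Rightarrow> (nat \<Rightarrow> nat) \<Rightarrow> (nat \<times> bool) list \<Rightarrow> nat" where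
  "cost L R k w = sum_list (map (k \<circ> fst) w) + e0 * (length w - 1) + matches (lft L R) (rgt L R) w"

definition val :: "(nat \<Rightarrow> bool) \<Rightarrow> (nat \<Rightarrow> bool) \<Rightarrow> (nat \<Rightarrow> nat) \<Rightarrow> (nat \<times> bool) list \<Rightarrow> 'a" where
  "val L R k w = (if w = [] then one else E (lft L R (hd w)) (rgt L R (last w)) (cost L R k w))"

lemma val_append: "val L R k (u @ v) = mul (val L R k u) (val L R k v)"
proof (cases "u = [] \<or> v = []")
  case True then show ?thesis by (auto simp: val_def mul_one)
next
  case False
  then have "length (u @ v) - 1 = (length u - 1) + (length v - 1) + 1" by (cases u; cases v) auto
  then have "e0 * (length (u @ v) - 1) = e0 * (length u - 1) + e0 * (length v - 1) + e0"
    by (simp only: distrib_left mult_1_right)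
  moreover have "matches (lft L R) (rgt L R) (u @ v) = matches (lft L R) (rgt L R) u +
      of_bool (rgt L R (last u) = lft L R (hd v)) + matches (lft L R) (rgt L R) v"
    using False by (simp add: matches_append)
  ultimately have "cost L R k (u @ v) = cost L R k u + cost L R k v + e0 + of_bool (rgt L R (last u) = lft L R (hd v))"
    unfolding cost_def map_append sum_list_append by linarith
  then show ?thesis using False by (simp add: val_def mul_E)
qed

text \<open>Inversion reverses the pairs and passes both compared indices through \<open>d\<close>,
  which is injective.\<close>

lemma matches_winv: "matches (lft L R) (rgt L R) (winv w) = matches (lft L R) (rgt L R) w"
proof (induction w)
  case (Cons z w)
  have dual: "lft L R (x, \<not> b) = d (rgt L R (x, b))" "rgt L R (x, \<not> b) = d (lft L R (x, b))" for x b
    by (auto simp: lft_def rgt_def)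
  show ?case
  proof (cases w)
    case Nil then show ?thesis by (simp add: winv_def)
  next
    case (Cons y ys)
    obtain x b where z: "z = (x, b)" by force
    obtain x' b' where y: "y = (x', b')" by force
    have "winv (z # w) = winv w @ [(x, \<not> b)]" "winv w \<noteq> []" "last (winv w) = (x', \<not> b')"
      using Cons z y by (simp_all add: winv_def)
    then show ?thesis using Cons.IH Cons z y by (auto simp: matches_append dual)
  qed
qed simp

lemma val_winv: "val L R k (winv w) = iv (val L R k w)"
proof (cases "w = []")
  case True then show ?thesis by (simp add: val_def iv_one)
next
  case False
  have h: "hd (winv w) = (fst (last w), \<not> snd (last w))" "last (winv w) = (fst (hd w), \<not> snd (hd w))"
    using False by (auto simp: winv_def hd_rev last_rev last_map hd_map case_prod_beta)
  have "sum_list (map (k \<circ> fst) (winv w)) = sum_list (map (k \<circ> fst) w)"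
    by (induction w) (auto simp: winv_def)
  then have "cost L R k (winv w) = cost L R k w" by (simp add: cost_def matches_winv)
  then show ?thesis using False h by (auto simp: val_def iv_E lft_def rgt_def)
qed

lemma filter_winv: "filter (\<lambda>z. fst z \<in> X) (winv w) = winv (filter (\<lambda>z. fst z \<in> X) w)"
  by (induction w) (auto simp: winv_def)

lemma ieval_val:
  "ieval mul iv (\<lambda>x. if x \<in> X then E (L x) (R x) (k x) else one) s =
    val L R k (filter (\<lambda>z. fst z \<in> X) (word s))"
proof (induction s)
  case (Var x) then show ?case by (simp add: val_def cost_def lft_def rgt_def)
qed (simp_all add: val_append val_winv filter_winv)

lemma identity_val:
  assumes "(s, t) \<in> Id_of A mul iv"
  shows "val L R k (filter (\<lambda>z. fst z \<in> X) (word s)) = val L R k (filter (\<lambda>z. fst z \<in> X) (word t))"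
proof -
  let ?f = "\<lambda>x. if x \<in> X then E (L x) (R x) (k x) else one"
  have f: "\<forall>x. ?f x \<in> A" using one_in E_in by simp
  have "ieval mul iv f s = ieval mul iv f t" if "\<forall>x. f x \<in> A" for f
    using assms that by (auto simp: Id_of_def)
  from this[OF f] have "ieval mul iv ?f s = ieval mul iv ?f t" .
  then show ?thesis by (simp only: ieval_val)
qed

lemma val_eqD:
  assumes "val L R k u = val L R k v"
  shows "u = [] \<longleftrightarrow> v = []"
    and "u \<noteq> [] \<Longrightarrow> lft L R (hd u) = lft L R (hd v)"
    and "u \<noteq> [] \<Longrightarrow> rgt L R (last u) = rgt L R (last v)"
    and "cost L R k u = cost L R k v"
  using assms E_one E_one[symmetric] E_inj unfolding val_def by (auto split: if_splits)

text \<open>Evaluating all other variables at \<open>one\<close> leaves words in one variable. The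
  circles give the length, the left index gives the first sign, and a change of sign in
  \<open>t\<close> would alter the number of matches for suitable indices.\<close>

lemma identity_same_var:
  assumes st: "(s, t) \<in> Id_of A mul iv" and os: "one_signed (word s)"
  shows "filter (\<lambda>z. fst z = x) (word t) = filter (\<lambda>z. fst z = x) (word s)"
proof -
  define u where "u = filter (\<lambda>z. fst z = x) (word s)"
  define v where "v = filter (\<lambda>z. fst z = x) (word t)"
  have val: "val L R k u = val L R k v" for L R k
    using identity_val[OF st, of L R k "{x}"] by (simp add: u_def v_def)
  have su: "sum_list (map ((\<lambda>_. 1) \<circ> fst) w) = length w" "sum_list (map ((\<lambda>_. 0) \<circ> fst) w) = 0"
    for w :: "(nat \<times> bool) list" by (induction w) auto
  \<comment> \<open>Raising \<open>k\<close> from 0 to 1 increases the cost by exactly the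
    length.\<close>
  have len: "length u = length v"
    using val_eqD(4)[OF val, of "\<lambda>_. True" "\<lambda>_. True" "\<lambda>_. 1"] val_eqD(4)[OF val, of "\<lambda>_. True" "\<lambda>_. True" "\<lambda>_. 0"]
    unfolding cost_def su by linarith
  have mat: "matches (lft L R) (rgt L R) u = matches (lft L R) (rgt L R) v" for L R
    using val_eqD(4)[OF val, of L R "\<lambda>_. 0"] len by (simp add: cost_def su)
  show ?thesis
  proof (cases "u = []")
    case True then show ?thesis using len by (simp add: u_def v_def)
  next
    case False
    define b where "b = snd (hd u)"
    have fst_u: "fst z = x" if "z \<in> set u" for z using that by (auto simp: u_def)
    have fst_v: "fst z = x" if "z \<in> set v" for z using that by (auto simp: v_def)
    have "snd z = b" if "z \<in> set u" for z
    proof -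
      have mem: "(x, snd y) \<in> set (word s)" if "y \<in> set u" for y
      proof -
        obtain x' b' where "y = (x', b')" by force
        then show ?thesis using that by (auto simp: u_def)
      qed
      have "hd u \<in> set u" using False by simp
      then have "(x, b) \<in> set (word s)" "(x, snd z) \<in> set (word s)"
        using mem that unfolding b_def by blast+
      then show ?thesis using os unfolding one_signed_def by (metis (full_types))
    qed
    then have all_u: "\<forall>z\<in>set u. z = (x, b)" using fst_u prod_eqI[of _ "(x, b)"] by fastforce
    have pu: "a = (x, b) \<and> c = (x, b)" if "(a, c) \<in> adjs u" for a c
    proof -
      have "a \<in> set u" "c \<in> set u" using set_mp[OF adjs_subset that] by auto
      then show ?thesis using all_u by blast
    qed
    have adj_v: "snd a = snd c" if ac: "(a, c) \<in> adjs v" for a c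
    proof -
      from d show ?thesis
      proof
        assume "d = Not"
        then have d: "d b = (\<not> b)" for b by simp
        \<comment> \<open>Under negation both indices now equal the sign, so a match means equal
          signs, and all pairs of \<open>u\<close> match.\<close>
        let ?l = "lft (\<lambda>_. True) (\<lambda>_. True)" and ?r = "rgt (\<lambda>_. True) (\<lambda>_. True)"
        have "?r a = ?l c" if "(a, c) \<in> adjs u" for a c
          using pu[OF that] by (simp add: lft_def rgt_def d)
        then have "\<forall>(a, c)\<in>set (zip u (tl u)). ?r a = ?l c" unfolding adjs_def by blast
        from filter_True[OF this] have "matches ?l ?r u = length (zip u (tl u))"
          unfolding matches_def by simp
        then have "length (filter (\<lambda>(a, b). ?r a = ?l b) (zip v (tl v))) = length (zip v (tl v))"
          using mat len unfolding matches_def by simp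
        then have "\<forall>(a, b) \<in> set (zip v (tl v)). ?r a = ?l b"
          using length_filter_less[of _ "zip v (tl v)" "\<lambda>(a, b). ?r a = ?l b"] by fastforce
        then have "?r a = ?l c" using ac by (auto simp: adjs_def)
        then show ?thesis by (auto simp: lft_def rgt_def d split: if_splits)
      next
        assume "d = id"
        then have d: "d b = b" for b by simp
        \<comment> \<open>The left index is now the sign and the right index its negation, so a
          match means different signs, and \<open>u\<close> has none.\<close>
        let ?l = "lft (\<lambda>_. True) (\<lambda>_. False)" and ?r = "rgt (\<lambda>_. True) (\<lambda>_. False)"
        have "?r a \<noteq> ?l c" if "(a, c) \<in> adjs u" for a c
          using pu[OF that] by (simp add: lft_def rgt_def d)
        then have "\<forall>p\<in>set (zip u (tl u)). \<not> (case p of (a, c) \<Rightarrow> ?r a = ?l c)" unfolding adjs_def by blast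
        from filter_False[OF this] have "matches ?l ?r u = 0"
          unfolding matches_def by simp
        then have "filter (\<lambda>(a, b). ?r a = ?l b) (zip v (tl v)) = []"
          using mat unfolding matches_def by simp
        then have "?r a \<noteq> ?l c" using ac by (auto simp: adjs_def filter_empty_conv)
        then show ?thesis by (auto simp: lft_def rgt_def d split: if_splits)
      qed
    qed
    have const: "\<forall>z\<in>set w. snd z = snd (hd w)" if "\<forall>(a, c)\<in>adjs w. snd a = snd c"
      for w :: "(nat \<times> bool) list"
      using that
    proof (induction w)
      case (Cons a w) then show ?case by (cases w) auto
    qed simp
    \<comment> \<open>This choice makes the left index equal to the sign for either value of
      \<open>d\<close>.\<close>
    have "lft (\<lambda>_. True) (\<lambda>_. d False) (hd u) = lft (\<lambda>_. True) (\<lambda>_. d False) (hd v)"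
      using val_eqD(2)[OF val False] .
    then have "snd (hd v) = b" by (auto simp: lft_def b_def split: if_splits)
    moreover have "\<forall>(a, c)\<in>adjs v. snd a = snd c" using adj_v by blast
    ultimately have "\<forall>z\<in>set v. snd z = b" using const[of v] by simp
    then have all_v: "\<forall>z\<in>set v. z = (x, b)" using fst_v prod_eqI[of _ "(x, b)"] by fastforce
    have "u = replicate (length u) (x, b)" "v = replicate (length v) (x, b)"
      using all_u all_v by (simp_all add: replicate_length_same)
    then have "u = v" using len by simp
    then show ?thesis by (simp add: u_def v_def)
  qed
qed

text \<open>In a one-signed word both indices of each letter can be prescribed freely, so the
  numbers of matches agree for all \<open>l\<close> and \<open>r\<close>, which determines the
  adjacencies.\<close>

lemma identity_same_adj:
  assumes st: "(s, t) \<in> Id_of A mul iv" and os: "one_signed (word s)"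
  shows "same_adj (word s) (word t)"
proof -
  have m: "mset (word s) = mset (word t)"
  proof (rule multiset_eqI)
    fix z :: "nat \<times> bool"
    have cnt: "count (mset w) z = count (mset (filter (\<lambda>y. fst y = fst z) w)) z" for w
      by (induction w) auto
    then show "count (mset (word s)) z = count (mset (word t)) z"
      using identity_same_var[OF st os, of "fst z"] cnt by metis
  qed
  then have set: "set (word t) = set (word s)" by (metis set_mset_mset)
  have key: "filter Z (word s) \<noteq> [] \<longrightarrow> hd (filter Z (word t)) = hd (filter Z (word s)) \<and>
      adjs (filter Z (word s)) = adjs (filter Z (word t))" for Z
  proof
    \<comment> \<open>Deleting letters amounts to deleting variables, because each variable has only
      one sign.\<close>
    define X where "X = {x. \<exists>b. (x, b) \<in> set (word s) \<and> Z (x, b)}"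
    define u where "u = filter Z (word s)"
    define v where "v = filter Z (word t)"
    assume "filter Z (word s) \<noteq> []"
    then have ne: "u \<noteq> []" by (simp add: u_def)
    have FX: "filter (\<lambda>z. fst z \<in> X) w = filter Z w" if "set w \<subseteq> set (word s)" for w
    proof (rule filter_cong[OF refl])
      fix z assume "z \<in> set w"
      then have z: "(fst z, snd z) \<in> set (word s)" using that by auto
      have "b = snd z" if "(fst z, b) \<in> set (word s)" for b
        using os z that unfolding one_signed_def by (cases b; cases "snd z") auto
      then have "(\<exists>b. (fst z, b) \<in> set (word s) \<and> Z (fst z, b)) \<longleftrightarrow> Z (fst z, snd z)" using z by blast
      then show "(fst z \<in> X) = Z z" by (simp add: X_def)
    qed
    have mu: "mset u = mset v" using m by (simp add: u_def v_def)
    then have len: "length u = length v" by (metis size_mset)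
    have ne': "v \<noteq> []" using ne len by auto
    have sub: "set u \<subseteq> set (word s)" "set v \<subseteq> set (word s)" using set by (auto simp: u_def v_def)
    have all: "l (hd u) = l (hd v) \<and> r (last u) = r (last v) \<and> matches l r u = matches l r v"
      for l r :: "nat \<times> bool \<Rightarrow> bool"
    proof -
      \<comment> \<open>\<open>lft\<close> and \<open>rgt\<close> solved for \<open>L\<close> and
        \<open>R\<close>; for starred letters this uses that \<open>d\<close> is an
        involution.\<close>
      define L where "L x = (if (x, True) \<in> set (word s) then l (x, True) else d (r (x, False)))" for x
      define R where "R x = (if (x, True) \<in> set (word s) then r (x, True) else d (l (x, False)))" for x
      have lr: "lft L R z = l z \<and> rgt L R z = r z" if "z \<in> set (word s)" for z
      proof -
        obtain x b where z: "z = (x, b)" by force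
        show ?thesis
        proof (cases b)
          case True then show ?thesis using that by (simp add: z lft_def rgt_def L_def R_def)
        next
          case False
          then have "(x, True) \<notin> set (word s)" using that os z unfolding one_signed_def by auto
          then show ?thesis using False by (simp add: z lft_def rgt_def L_def R_def)
        qed
      qed
      have v: "val L R (\<lambda>_. 0) u = val L R (\<lambda>_. 0) v"
        using identity_val[OF st, of L R "\<lambda>_. 0" X] FX[of "word s"] FX[of "word t"] set
        by (simp add: u_def v_def)
      have "matches (lft L R) (rgt L R) u = matches (lft L R) (rgt L R) v"
        using val_eqD(4)[OF v] len mu by (simp add: cost_def o_def sum_list_triv map_replicate_const)
      moreover have "matches (lft L R) (rgt L R) w = matches l r w" if "set w \<subseteq> set (word s)" for w
        by (rule matches_cong) (use lr that in auto)
      moreover have "hd u \<in> set (word s)" "hd v \<in> set (word s)" "last u \<in> set (word s)" "last v \<in> set (word s)"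
        using ne ne' sub by auto
      ultimately show ?thesis using val_eqD(2,3)[OF v ne] lr sub by simp
    qed
    have "hd v = hd u" using all[of "\<lambda>z. z = hd u" "\<lambda>_. True"] by simp
    moreover have "adjs u = adjs v" by (rule adjs_eq_if_matches_eq[OF mu ne]) (use all in blast)+
    ultimately show "hd (filter Z (word t)) = hd (filter Z (word s)) \<and>
      adjs (filter Z (word s)) = adjs (filter Z (word t))" by (simp add: u_def v_def)
  qed
  have "filter Z (word t) = []" if "filter Z (word s) = []" for Z
    using that set by (auto simp: filter_empty_conv)
  then have "adjs (filter Z (word t)) \<subseteq> adjs (filter Z (word s))" for Z
    using key[of Z] by (cases "filter Z (word s) = []") auto
  then show ?thesis unfolding same_adj_def using m key by blast
qed

end


section \<open>Computing products of pairings\<close>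

definition blocks :: "(pt \<times> pt) list \<Rightarrow> pt set set" where
  "blocks ps = (\<lambda>(a, b). {a, b}) ` set ps"

definition edges :: "(pt \<times> pt) list \<Rightarrow> (pt \<times> pt) list \<Rightarrow> (gv \<times> gv) list" where
  "edges ps qs = map (map_prod sig sig) ps @ map (map_prod tau tau) qs"

lemma gadj_blocks:
  "gadj (blocks ps) (blocks qs) x y \<longleftrightarrow> (x, y) \<in> set (edges ps qs) \<or> (y, x) \<in> set (edges ps qs)"
proof -
  have "{x, y} \<in> image f ` blocks ps \<longleftrightarrow>
      (x, y) \<in> set (map (map_prod f f) ps) \<or> (y, x) \<in> set (map (map_prod f f) ps)" for f :: "pt \<Rightarrow> gv" and ps
    unfolding blocks_def image_image by (force simp: doubleton_eq_iff)
  then show ?thesis unfolding gadj_def edges_def by auto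
qed

text \<open>Union-find: two vertices carry the same label iff they are connected.\<close>

fun lab :: "(gv \<times> gv) list \<Rightarrow> gv \<Rightarrow> gv" where
  "lab [] z = z"
| "lab (e # es) z = (if lab es z = lab es (fst e) then lab es (snd e) else lab es z)"

text \<open>The recursion of \<open>lab\<close> branches at every edge; a table of labels over the
  vertex list handles each edge once and keeps evaluation feasible.\<close>

fun labs :: "gv list \<Rightarrow> (gv \<times> gv) list \<Rightarrow> (gv \<times> gv) list" where
  "labs V [] = map (\<lambda>z. (z, z)) V"
| "labs V (e # es) = (let T = labs V es; a = the (map_of T (fst e)); b = the (map_of T (snd e))
     in map (\<lambda>(z, l). (z, if l = a then b else l)) T)"

lemma labs_eq:
  assumes "\<forall>e\<in>set es. fst e \<in> set V \<and> snd e \<in> set V"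
  shows "labs V es = map (\<lambda>z. (z, lab es z)) V"
  using assms
proof (induction es)
  case (Cons e es)
  have "map_of (map (\<lambda>z. (z, g z)) V) z = Some (g z)" if "z \<in> set V" for g :: "gv \<Rightarrow> gv" and z
    using that by (simp add: map_of_map_restrict)
  then show ?case using Cons by (auto simp: Let_def)
qed simp

lemma lab_closed:
  assumes "\<forall>e\<in>set es. fst e \<in> V \<and> snd e \<in> V"
  shows "(z \<in> V \<longrightarrow> lab es z \<in> V) \<and> (z \<notin> V \<longrightarrow> lab es z = z)"
  using assms
proof (induction es arbitrary: z)
  case (Cons e es)
  then show ?case using Cons.IH[of z] Cons.IH[of "fst e"] Cons.IH[of "snd e"] by auto
qed simp

lemma lab_edge: "(u, v) \<in> set es \<Longrightarrow> lab es u = lab es v"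
proof (induction es)
  case (Cons e es) then show ?case by (cases "e = (u, v)") simp_all
qed simp

lemma rtranclp_iff_lab:
  "(\<lambda>x y. (x, y) \<in> set es \<or> (y, x) \<in> set es)\<^sup>*\<^sup>* x y \<longleftrightarrow> lab es x = lab es y"
proof
  assume "(\<lambda>x y. (x, y) \<in> set es \<or> (y, x) \<in> set es)\<^sup>*\<^sup>* x y"
  then show "lab es x = lab es y"
  proof (induction rule: rtranclp_induct)
    case (step y z)
    have "lab es y = lab es z" using step(2) lab_edge[of y z es] lab_edge[of z y es] by auto
    then show ?case using step(3) by simp
  qed simp
next
  show "lab es x = lab es y \<Longrightarrow> (\<lambda>x y. (x, y) \<in> set es \<or> (y, x) \<in> set es)\<^sup>*\<^sup>* x y"
  proof (induction es arbitrary: x y)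
    case Nil then show ?case by simp
  next
    case (Cons e es)
    obtain u v where e: "e = (u, v)" by force
    let ?R = "\<lambda>x y. (x, y) \<in> set (e # es) \<or> (y, x) \<in> set (e # es)"
    have mono: "?R\<^sup>*\<^sup>* x y" if "lab es x = lab es y" for x y
      using Cons.IH[OF that] by (rule rtranclp_mono[THEN predicate2D, rotated]) auto
    have uv: "?R\<^sup>*\<^sup>* u v" "?R\<^sup>*\<^sup>* v u" using e by auto
    consider "lab es x = lab es y" | "lab es x = lab es u" "lab es v = lab es y"
      | "lab es x = lab es v" "lab es u = lab es y"
      using Cons.prems e by (auto split: if_splits)
    then show ?case
    proof cases
      case 1 then show ?thesis by (rule mono)
    next
      case 2 show ?thesis by (rule rtranclp_trans[OF mono[OF 2(1)] rtranclp_trans[OF uv(1) mono[OF 2(2)]]])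
    next
      case 3 show ?thesis by (rule rtranclp_trans[OF mono[OF 3(1)] rtranclp_trans[OF uv(2) mono[OF 3(2)]]])
    qed
  qed
qed

lemma gconn_blocks: "gconn (blocks ps) (blocks qs) x y \<longleftrightarrow> lab (edges ps qs) x = lab (edges ps qs) y"
  unfolding gconn_def rtranclp_iff_lab[symmetric]
  by (rule arg_cong[where f = "\<lambda>R. R\<^sup>*\<^sup>* x y"]) (auto simp: gadj_blocks fun_eq_iff)

definition ptl :: "nat \<Rightarrow> pt list" where
  "ptl n = map Top [1..<Suc n] @ map Bot [1..<Suc n]"

definition gvl :: "nat \<Rightarrow> gv list" where
  "gvl n = map GU [1..<Suc n] @ map GM [1..<Suc n] @ map GL [1..<Suc n]"

fun upairs :: "'a list \<Rightarrow> ('a \<times> 'a) list" where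
  "upairs [] = []"
| "upairs (x # xs) = map (Pair x) xs @ upairs xs"

definition prodl :: "nat \<Rightarrow> (pt \<times> pt) list \<Rightarrow> (pt \<times> pt) list \<Rightarrow> (pt \<times> pt) list \<times> nat" where
  "prodl n ps qs = (let T = labs (gvl n) (edges ps qs); L = map (\<lambda>a. (a, the (map_of T (outer a)))) (ptl n);
     out = map snd L
     in (map (\<lambda>(x, y). (fst x, fst y)) (filter (\<lambda>(x, y). snd x = snd y) (upairs L)),
         length (remdups (filter (\<lambda>l. l \<notin> set out) (map (\<lambda>k. the (map_of T (GM k))) [1..<Suc n])))))"

definition on_pts :: "nat \<Rightarrow> (pt \<times> pt) list \<Rightarrow> bool" where
  "on_pts n ps \<longleftrightarrow> (\<forall>(a, b)\<in>set ps. a \<in> set (ptl n) \<and> b \<in> set (ptl n))"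

lemma set_ptl: "set (ptl n) = pts n"
  by (auto simp: ptl_def pts_def)

lemma set_upairs: "distinct xs \<Longrightarrow> a \<in> set xs \<Longrightarrow> b \<in> set xs \<Longrightarrow> a \<noteq> b \<Longrightarrow>
    (a, b) \<in> set (upairs xs) \<or> (b, a) \<in> set (upairs xs)"
  by (induction xs) auto

lemma set_upairsD: "distinct xs \<Longrightarrow> (a, b) \<in> set (upairs xs) \<Longrightarrow> a \<in> set xs \<and> b \<in> set xs \<and> a \<noteq> b"
  by (induction xs) auto

lemma upairs_map: "upairs (map f xs) = map (map_prod f f) (upairs xs)"
  by (induction xs) auto

text \<open>Equal labels mean equal components. A component counts as a cycle exactly when no outer
  vertex carries its label, so counting such labels counts cycles.\<close>

lemma wprod_blocks:
  assumes "on_pts n ps" "on_pts n qs"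
  shows "wprod_part (blocks ps) (blocks qs) = blocks (fst (prodl n ps qs))"
    and "wcycles n (blocks ps) (blocks qs) = snd (prodl n ps qs)"
proof -
  define es where "es = edges ps qs"
  define f where "f = lab es"
  define V where "V = set (gvl n)"
  have esV: "\<forall>e\<in>set es. fst e \<in> V \<and> snd e \<in> V"
  proof -
    have "sig a \<in> V \<and> tau a \<in> V" if "a \<in> set (ptl n)" for a
      using that by (auto simp: V_def gvl_def ptl_def)
    then show ?thesis using assms unfolding es_def edges_def on_pts_def by fastforce
  qed
  have fV: "f z \<in> V" if "z \<in> V" for z using lab_closed[OF esV] that by (simp add: f_def)
  have fnV: "f z = z" if "z \<notin> V" for z using lab_closed[OF esV] that by (simp add: f_def)
  have outV: "outer a \<in> V \<longleftrightarrow> a \<in> pts n" for a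
    by (cases a) (auto simp: V_def gvl_def pts_def)
  have gmV: "GM k \<in> V \<longleftrightarrow> k \<in> {1..n}" for k by (auto simp: V_def gvl_def)
  have T: "labs (gvl n) es = map (\<lambda>z. (z, f z)) (gvl n)"
    unfolding f_def by (rule labs_eq) (use esV V_def in auto)
  have look: "the (map_of (labs (gvl n) es) z) = f z" if "z \<in> V" for z
    using that unfolding T V_def by (simp add: map_of_map_restrict)
  have L: "map (\<lambda>a. (a, the (map_of (labs (gvl n) es) (outer a)))) (ptl n) = map (\<lambda>a. (a, f (outer a))) (ptl n)"
    using look outV set_ptl by auto
  have gm: "map (\<lambda>k. the (map_of (labs (gvl n) es) (GM k))) [1..<Suc n] = map (\<lambda>k. f (GM k)) [1..<Suc n]"
    using look gmV by auto
  have p1: "fst (prodl n ps qs) = filter (\<lambda>p. f (outer (fst p)) = f (outer (snd p))) (upairs (ptl n))"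
    unfolding prodl_def Let_def es_def[symmetric] L
    by (simp add: upairs_map filter_map o_def case_prod_beta)
  have p2: "snd (prodl n ps qs) = card (f ` GM ` {1..n} - f ` outer ` pts n)"
    unfolding prodl_def Let_def es_def[symmetric] L gm
    by (simp del: upt_Suc add: length_remdups_card_conv o_def set_ptl image_image set_diff_eq
        atLeastLessThanSuc_atLeastAtMost)
  have inj: "outer a = outer b \<longleftrightarrow> a = b" for a b by (cases a; cases b) auto
  have dist: "distinct (ptl n)" by (auto simp: ptl_def distinct_map inj_on_def)
  have gc: "gconn (blocks ps) (blocks qs) x y \<longleftrightarrow> f x = f y" for x y
    by (simp add: gconn_blocks f_def es_def)
  \<comment> \<open>\<open>wprod_part\<close> ranges over all points; a vertex outside the graph is
    alone in its component and yields no block.\<close>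
  have inpts: "a \<in> pts n" if ab: "a \<noteq> b" "f (outer a) = f (outer b)" for a b
  proof (rule ccontr)
    assume a: "a \<notin> pts n"
    then have 1: "f (outer a) = outer a" using fnV outV by simp
    then have "outer b \<notin> V" using fV[of "outer b"] ab(2) outV[of a] a by auto
    then have "f (outer b) = outer b" by (rule fnV)
    then show False using 1 ab inj[of a b] by simp
  qed
  show "wprod_part (blocks ps) (blocks qs) = blocks (fst (prodl n ps qs))"
  proof (intro set_eqI iffI)
    fix B assume "B \<in> wprod_part (blocks ps) (blocks qs)"
    then obtain a b where ab: "B = {a, b}" "a \<noteq> b" "f (outer a) = f (outer b)"
      unfolding wprod_part_def gc by blast
    then have "(a, b) \<in> set (upairs (ptl n)) \<or> (b, a) \<in> set (upairs (ptl n))"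
      using set_upairs[OF dist, of a b] inpts[of a b] inpts[of b a] set_ptl by simp
    then show "B \<in> blocks (fst (prodl n ps qs))"
    proof
      assume "(a, b) \<in> set (upairs (ptl n))"
      then have "(a, b) \<in> set (fst (prodl n ps qs))" using ab(3) unfolding p1 by simp
      then show ?thesis unfolding blocks_def ab(1) by (rule rev_image_eqI) simp
    next
      assume "(b, a) \<in> set (upairs (ptl n))"
      then have "(b, a) \<in> set (fst (prodl n ps qs))" using ab(3) unfolding p1 by simp
      then show ?thesis unfolding blocks_def ab(1) by (rule rev_image_eqI) auto
    qed
  next
    fix B assume "B \<in> blocks (fst (prodl n ps qs))"
    then obtain a b where ab: "B = {a, b}" "(a, b) \<in> set (upairs (ptl n))" "f (outer a) = f (outer b)"
      unfolding p1 blocks_def by auto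
    have "a \<noteq> b" using set_upairsD[OF dist ab(2)] by simp
    then show "B \<in> wprod_part (blocks ps) (blocks qs)"
      using ab(1,3) unfolding wprod_part_def gc by auto
  qed
  let ?F = "\<lambda>l. {y. l = f y}"
  let ?S = "f ` GM ` {1..n} - f ` outer ` pts n"
  have nonGM: "\<exists>a. y = outer a" if "y \<notin> range GM" for y
  proof (cases y)
    case (GU k) then show ?thesis by (intro exI[of _ "Top k"]) simp
  next
    case (GL k) then show ?thesis by (intro exI[of _ "Bot k"]) simp
  qed (use that in auto)
  have outGM: "outer a \<notin> range GM" for a by (cases a) auto
  have cyc: "{y. f x = f y} \<subseteq> range GM \<longleftrightarrow> f x \<notin> f ` outer ` pts n" if xG: "x \<in> GM ` {1..n}" for x
  proof
    assume sub: "{y. f x = f y} \<subseteq> range GM"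
    show "f x \<notin> f ` outer ` pts n"
    proof
      assume "f x \<in> f ` outer ` pts n"
      then obtain a where "f x = f (outer a)" by auto
      then have "outer a \<in> range GM" using subsetD[OF sub, of "outer a"] by simp
      then show False using outGM by simp
    qed
  next
    assume nin: "f x \<notin> f ` outer ` pts n"
    obtain k where "x = GM k" "k \<in> {1..n}" using xG by (rule imageE)
    then have "x \<in> V" using gmV[of k] by simp
    show "{y. f x = f y} \<subseteq> range GM"
    proof (rule subsetI, rule ccontr)
      fix y assume y: "y \<in> {y. f x = f y}" "y \<notin> range GM"
      then obtain a where a: "y = outer a" using nonGM by blast
      have "y \<in> V"
      proof (rule ccontr)
        assume "y \<notin> V"
        then have "f y = y" by (rule fnV)
        then show False using y(1) fV[OF \<open>x \<in> V\<close>] \<open>y \<notin> V\<close> by simp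
      qed
      then have "a \<in> pts n" using a outV by simp
      then have "f y \<in> f ` outer ` pts n" using a by simp
      then show False using nin y(1) by simp
    qed
  qed
  have "{C. \<exists>x\<in>GM ` {1..n}. C = {y. f x = f y} \<and> C \<subseteq> range GM} = ?F ` ?S"
  proof (intro set_eqI iffI)
    fix C assume "C \<in> {C. \<exists>x\<in>GM ` {1..n}. C = {y. f x = f y} \<and> C \<subseteq> range GM}"
    then obtain x where x: "x \<in> GM ` {1..n}" "C = ?F (f x)" "C \<subseteq> range GM" by blast
    then have "f x \<in> ?S" using cyc[OF x(1)] by simp
    then show "C \<in> ?F ` ?S" unfolding x(2) by (rule imageI)
  next
    fix C assume "C \<in> ?F ` ?S"
    then obtain l where l: "C = ?F l" "l \<in> ?S" by (rule imageE)
    from l(2) obtain x where x: "x \<in> GM ` {1..n}" "l = f x" by (auto simp only: Diff_iff image_iff)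
    then have "C = {y. f x = f y} \<and> C \<subseteq> range GM" using l cyc[OF x(1)] by simp
    then show "C \<in> {C. \<exists>x\<in>GM ` {1..n}. C = {y. f x = f y} \<and> C \<subseteq> range GM}"
      using x(1) by (intro CollectI bexI[of _ x])
  qed
  moreover have "inj_on ?F ?S"
  proof (rule inj_onI)
    fix l l' assume "l \<in> ?S" and eq: "?F l = ?F l'"
    then obtain y where y: "l = f y" by (auto simp only: Diff_iff image_iff)
    then have "y \<in> ?F l'" unfolding eq[symmetric] by simp
    then show "l = l'" using y by simp
  qed
  ultimately show "wcycles n (blocks ps) (blocks qs) = snd (prodl n ps qs)"
    unfolding wcycles_def gc p2 by (simp add: card_image)
qed

lemma wmult_blocks:
  assumes "on_pts n ps" "on_pts n qs" "prodl n ps qs = (rs, c)"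
  shows "wmult n (blocks ps, k) (blocks qs, l) = (blocks rs, k + l + c)"
  using wprod_blocks[OF assms(1,2)] assms(3) by (simp add: wmult_def)

lemma wstar_blocks: "wstar (blocks ps, k) = (blocks (map (map_prod flip flip) ps), k)"
  unfolding wstar_def blocks_def by (force simp: image_image)

definition onel :: "nat \<Rightarrow> (pt \<times> pt) list" where
  "onel n = map (\<lambda>j. (Top j, Bot j)) [1..<Suc n]"

definition alphal :: "nat \<Rightarrow> (pt \<times> pt) list" where
  "alphal n = map (\<lambda>j. (Top j, Bot (n + 1 - j))) [1..<Suc n]"

lemma wone_blocks: "wone n = (blocks (onel n), 0)"
  and circle_blocks: "circle n = (blocks (onel n), 1)"
  and walpha_blocks: "walpha n = (blocks (alphal n), 0)"
  by (auto simp: wone_def circle_def walpha_def blocks_def onel_def alphal_def image_image image_iff)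

definition rhol :: "nat \<Rightarrow> (pt \<times> pt) list \<Rightarrow> (pt \<times> pt) list \<times> nat" where
  "rhol n ps = (let (qs, c) = prodl n (alphal n) (map (map_prod flip flip) ps); (rs, c') = prodl n qs (alphal n)
     in (rs, c + c'))"

lemma on_pts_prodl: "on_pts n (fst (prodl n ps qs))"
proof -
  have "\<forall>(a, b)\<in>set (upairs xs). a \<in> set xs \<and> b \<in> set xs" for xs :: "(pt \<times> gv) list"
    by (induction xs) auto
  then show ?thesis unfolding on_pts_def prodl_def Let_def by fastforce
qed

lemma on_pts_alphal: "on_pts n (alphal n)"
  by (auto simp: on_pts_def alphal_def ptl_def)

lemma on_pts_flip: "on_pts n ps \<Longrightarrow> on_pts n (map (map_prod flip flip) ps)"
proof -
  have "a \<in> set (ptl n) \<Longrightarrow> flip a \<in> set (ptl n)" for a by (auto simp: ptl_def)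
  then show "on_pts n ps \<Longrightarrow> ?thesis" unfolding on_pts_def by fastforce
qed

lemma rho_blocks:
  assumes "on_pts n ps" "rhol n ps = (rs, 0)"
  shows "rho n (blocks ps, k) = (blocks rs, k)"
proof -
  obtain qs c where qs: "prodl n (alphal n) (map (map_prod flip flip) ps) = (qs, c)" by force
  obtain rs' c' where rs': "prodl n qs (alphal n) = (rs', c')" by force
  have "on_pts n qs" using on_pts_prodl[of n "alphal n" "map (map_prod flip flip) ps"] qs by simp
  then show ?thesis
    using assms(2) qs rs' wmult_blocks[OF on_pts_alphal on_pts_flip[OF assms(1)] qs]
      wmult_blocks[OF _ on_pts_alphal rs']
    by (simp add: rho_def wstar_blocks walpha_blocks rhol_def)
qed

section \<open>The sections in \<open>K 3\<close> and \<open>K 4\<close>\<close>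

text \<open>In \<open>K 3\<close> the index \<open>True\<close> is the cup on \<open>1, 2\<close> and \<open>False\<close> the cup on \<open>2, 3\<close>; the rotation swaps
  them. In \<open>K 4\<close> the pairings without through-strands are used: \<open>True\<close> is \<open>12|34\<close> and \<open>False\<close> is
  \<open>14|23\<close>, both invariant under the rotation.\<close>

definition E3 :: "bool \<Rightarrow> bool \<Rightarrow> (pt \<times> pt) list" where
  "E3 l r = (if l then
     (if r then [(Top 1, Top 2), (Top 3, Bot 3), (Bot 1, Bot 2)] else [(Top 1, Top 2), (Top 3, Bot 1), (Bot 2, Bot 3)])
    else
     (if r then [(Top 1, Bot 3), (Top 2, Top 3), (Bot 1, Bot 2)] else [(Top 1, Bot 1), (Top 2, Top 3), (Bot 2, Bot 3)]))"

definition E4 :: "bool \<Rightarrow> bool \<Rightarrow> (pt \<times> pt) list" where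
  "E4 l r = (if l then [(Top 1, Top 2), (Top 3, Top 4)] else [(Top 1, Top 4), (Top 2, Top 3)]) @
     (if r then [(Bot 1, Bot 2), (Bot 3, Bot 4)] else [(Bot 1, Bot 4), (Bot 2, Bot 3)])"


text \<open>Equal cups in the middle row close a circle; different ones join into a strand.\<close>

lemma prodl_E3: "prodl 3 (E3 l r) (E3 l' r') = (E3 l r', of_bool (r = l'))"
  by (induct l rule: bool.induct; induct r rule: bool.induct; induct l' rule: bool.induct;
      induct r' rule: bool.induct; code_simp)

text \<open>Equal pairings of the four middle points form two circles, different ones a single
  circle; hence \<open>e0 = 1\<close>.\<close>

lemma prodl_E4: "prodl 4 (E4 l r) (E4 l' r') = (E4 l r', 1 + of_bool (r = l'))"
  by (induct l rule: bool.induct; induct r rule: bool.induct; induct l' rule: bool.induct;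
      induct r' rule: bool.induct; code_simp)

lemma prodl_onel_E3: "prodl 3 (onel 3) (E3 l r) = (E3 l r, 0)" "prodl 3 (E3 l r) (onel 3) = (E3 l r, 0)"
  and rhol_E3: "rhol 3 (E3 l r) = (E3 (\<not> r) (\<not> l), 0)"
  by (induct l rule: bool.induct; induct r rule: bool.induct; code_simp)+

lemma prodl_onel_E4: "prodl 4 (onel 4) (E4 l r) = (E4 l r, 0)" "prodl 4 (E4 l r) (onel 4) = (E4 l r, 0)"
  and rhol_E4: "rhol 4 (E4 l r) = (E4 r l, 0)"
  by (induct l rule: bool.induct; induct r rule: bool.induct; code_simp)+

lemma prodl_onel: "prodl 3 (onel 3) (onel 3) = (onel 3, 0)" "prodl 4 (onel 4) (onel 4) = (onel 4, 0)"
  and rhol_onel: "rhol 3 (onel 3) = (onel 3, 0)" "rhol 4 (onel 4) = (onel 4, 0)"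
  by code_simp+

lemma on_pts_onel: "on_pts n (onel n)"
  by (auto simp: on_pts_def onel_def ptl_def)

lemma on_pts_E3: "on_pts 3 (E3 l r)" and on_pts_E4: "on_pts 4 (E4 l r)"
  by (auto simp: on_pts_def E3_def E4_def set_ptl pts_def)

section \<open>Generating the sections from the hooks and the circle\<close>

definition hookl :: "nat \<Rightarrow> nat \<Rightarrow> (pt \<times> pt) list" where
  "hookl n i = [(Top i, Top (i + 1)), (Bot i, Bot (i + 1))] @
     map (\<lambda>j. (Top j, Bot j)) (filter (\<lambda>j. j \<noteq> i \<and> j \<noteq> i + 1) [1..<Suc n])"

lemma hook_blocks: "hook n i = (blocks (hookl n i), 0)"
  by (auto simp: hook_def hookl_def blocks_def image_image image_iff)

lemma on_pts_hookl: "1 \<le> i \<Longrightarrow> i < n \<Longrightarrow> on_pts n (hookl n i)"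
  by (auto simp: on_pts_def hookl_def set_ptl pts_def)

text \<open>Multiplying by \<open>onel\<close> puts the list of a hook into the order produced by
  \<open>prodl\<close>, which \<open>E3\<close> and \<open>E4\<close> follow. In \<open>K 4\<close>,
  multiplying by the second hook changes the index on that side from \<open>True\<close> to
  \<open>False\<close>.\<close>

lemma prodl_hookl:
  "prodl 3 (onel 3) (hookl 3 1) = (E3 True True, 0)" "prodl 3 (onel 3) (hookl 3 2) = (E3 False False, 0)"
  "prodl 4 (hookl 4 1) (hookl 4 3) = (E4 True True, 0)"
  "prodl 4 (E4 True True) (hookl 4 2) = (E4 True False, 0)"
  "prodl 4 (hookl 4 2) (E4 True True) = (E4 False True, 0)"
  "prodl 4 (E4 False True) (hookl 4 2) = (E4 False False, 0)"
  by code_simp+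

lemma K_blocks_mult:
  assumes "(blocks ps, k) \<in> K n" "(blocks qs, l) \<in> K n" "on_pts n ps" "on_pts n qs" "prodl n ps qs = (rs, c)"
  shows "(blocks rs, k + l + c) \<in> K n"
  using K.K_mult[OF assms(1,2)] wmult_blocks[OF assms(3-5)] by simp

lemma K_blocks_add:
  assumes "(blocks ps, 0) \<in> K n" "on_pts n ps" "prodl n ps (onel n) = (ps, 0)"
  shows "(blocks ps, k) \<in> K n"
proof (induction k)
  case (Suc k)
  have "(blocks (onel n), 1) \<in> K n" using K.K_circle[of n] by (simp add: circle_blocks)
  from K_blocks_mult[OF Suc this assms(2) on_pts_onel assms(3)] show ?case by simp
qed (rule assms(1))

lemma K_hookl: "1 \<le> i \<Longrightarrow> i < n \<Longrightarrow> (blocks (hookl n i), 0) \<in> K n"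
  using K.K_hook[of i n] by (simp add: hook_blocks)

lemma E3_in_K: "(blocks (E3 l r), k) \<in> K 3"
proof -
  have one: "(blocks (onel 3), 0) \<in> K 3" using K.K_one[of 3] by (simp add: wone_blocks)
  have tt: "(blocks (E3 True True), 0) \<in> K 3" and ff: "(blocks (E3 False False), 0) \<in> K 3"
    using K_blocks_mult[OF one K_hookl on_pts_onel on_pts_hookl prodl_hookl(1)]
      K_blocks_mult[OF one K_hookl on_pts_onel on_pts_hookl prodl_hookl(2)] by simp_all
  have tf: "(blocks (E3 True False), 0) \<in> K 3" and ft: "(blocks (E3 False True), 0) \<in> K 3"
    using K_blocks_mult[OF tt ff on_pts_E3 on_pts_E3 prodl_E3]
      K_blocks_mult[OF ff tt on_pts_E3 on_pts_E3 prodl_E3] by simp_all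
  have "(blocks (E3 l r), 0) \<in> K 3" using tt ff tf ft by (cases l; cases r) simp_all
  then show ?thesis by (rule K_blocks_add[OF _ on_pts_E3 prodl_onel_E3(2)])
qed

lemma E4_in_K: "(blocks (E4 l r), k) \<in> K 4"
proof -
  have h2: "(blocks (hookl 4 2), 0) \<in> K 4" "on_pts 4 (hookl 4 2)"
    by (simp_all add: K_hookl on_pts_hookl)
  have tt: "(blocks (E4 True True), 0) \<in> K 4"
    using K_blocks_mult[OF K_hookl K_hookl on_pts_hookl on_pts_hookl prodl_hookl(3)] by simp
  have tf: "(blocks (E4 True False), 0) \<in> K 4"
    using K_blocks_mult[OF tt h2(1) on_pts_E4 h2(2) prodl_hookl(4)] by simp
  have ft: "(blocks (E4 False True), 0) \<in> K 4"
    using K_blocks_mult[OF h2(1) tt h2(2) on_pts_E4 prodl_hookl(5)] by simp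
  have ff: "(blocks (E4 False False), 0) \<in> K 4"
    using K_blocks_mult[OF ft h2(1) on_pts_E4 h2(2) prodl_hookl(6)] by simp
  have "(blocks (E4 l r), 0) \<in> K 4" using tt ff tf ft by (cases l; cases r) simp_all
  then show ?thesis by (rule K_blocks_add[OF _ on_pts_E4 prodl_onel_E4(2)])
qed

lemma cup_in_E3: "{Top 1, Top 2} \<in> blocks (E3 l r) \<longleftrightarrow> l" "{Bot 1, Bot 2} \<in> blocks (E3 l r) \<longleftrightarrow> r"
  and cup_in_E4: "{Top 1, Top 2} \<in> blocks (E4 l r) \<longleftrightarrow> l" "{Bot 1, Bot 2} \<in> blocks (E4 l r) \<longleftrightarrow> r"
  by (auto simp: blocks_def E3_def E4_def doubleton_eq_iff)

lemma blocks_E_not_onel: "blocks (E3 l r) \<noteq> blocks (onel 3)" "blocks (E4 l r) \<noteq> blocks (onel 4)"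
proof -
  have "{Top 2, Top 3} \<notin> blocks (onel n)" "{Top 1, Top 2} \<notin> blocks (onel n)" for n
    by (auto simp: blocks_def onel_def doubleton_eq_iff)
  moreover have "{Top 1, Top 2} \<in> blocks (E3 l r) \<or> {Top 2, Top 3} \<in> blocks (E3 l r)"
    "{Top 1, Top 2} \<in> blocks (E4 l r) \<or> {Top 2, Top 3} \<in> blocks (E4 l r)"
    by (cases l; cases r; simp add: blocks_def E3_def E4_def doubleton_eq_iff)+
  ultimately show "blocks (E3 l r) \<noteq> blocks (onel 3)" "blocks (E4 l r) \<noteq> blocks (onel 4)" by metis+
qed

interpretation K3: rees_rotation "K 3" "wmult 3" "rho 3" "wone 3" "\<lambda>l r k. (blocks (E3 l r), k)" 0 Not
proof
  fix l r k l' r' k'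
  show "(blocks (E3 l r), k) = (blocks (E3 l' r'), k') \<Longrightarrow> l = l' \<and> r = r' \<and> k = k'"
    using cup_in_E3 by (metis prod.inject)
qed (use E3_in_K K.K_one in \<open>auto simp: wone_blocks blocks_E_not_onel
      wmult_blocks[OF on_pts_E3 on_pts_E3 prodl_E3] wmult_blocks[OF on_pts_onel on_pts_onel prodl_onel(1)]
      wmult_blocks[OF on_pts_onel on_pts_E3 prodl_onel_E3(1)] wmult_blocks[OF on_pts_E3 on_pts_onel prodl_onel_E3(2)]
      rho_blocks[OF on_pts_E3 rhol_E3] rho_blocks[OF on_pts_onel rhol_onel(1)]\<close>)

interpretation K4: rees_rotation "K 4" "wmult 4" "rho 4" "wone 4" "\<lambda>l r k. (blocks (E4 l r), k)" 1 id
proof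
  fix l r k l' r' k'
  show "(blocks (E4 l r), k) = (blocks (E4 l' r'), k') \<Longrightarrow> l = l' \<and> r = r' \<and> k = k'"
    using cup_in_E4 by (metis prod.inject)
qed (use E4_in_K K.K_one in \<open>auto simp: wone_blocks blocks_E_not_onel
      wmult_blocks[OF on_pts_E4 on_pts_E4 prodl_E4] wmult_blocks[OF on_pts_onel on_pts_onel prodl_onel(2)]
      wmult_blocks[OF on_pts_onel on_pts_E4 prodl_onel_E4(1)] wmult_blocks[OF on_pts_E4 on_pts_onel prodl_onel_E4(2)]
      rho_blocks[OF on_pts_E4 rhol_E4] rho_blocks[OF on_pts_onel rhol_onel(2)]\<close>)

theorem theorem3:
  fixes m :: nat and T :: "(iterm \<times> iterm) set"
  assumes "m \<ge> 4"
    and "is_eq_theory T"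
    and "(IdW (m + 1) \<subseteq> T \<and> T \<subseteq> IdK 3) \<or> (IdW m \<subseteq> T \<and> T \<subseteq> IdK 4)"
  shows "\<not> finitely_based T"
  using assms(3)
proof
  assume "IdW (m + 1) \<subseteq> T \<and> T \<subseteq> IdK 3"
  then show ?thesis using not_finitely_based[OF assms(2)] K3.identity_same_adj by blast
next
  assume "IdW m \<subseteq> T \<and> T \<subseteq> IdK 4"
  then show ?thesis using not_finitely_based[OF assms(2)] K4.identity_same_adj by blast
qed

end
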